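(* In an unregulated market (described in the context), when firms adopt different XAI methods in the explanation-dominated market, an asymmetric equilibrium is not sustainable; that is, there is no equilibrium in which the firms' XAI levels differ, $\xi_1\neq\xi_2$.
   Context: Two firms $i=1,2$ are located at $e_1=0$, $e_2=1$ on a Hotelling line (different XAI methods; locations are exogenous). Parameters: $\beta>0$ (quality cost) and $t>0$ (misfit cost). Customers $(x,\theta)$ are uniformly distributed on $[0,1]^2$. A customer $(x,\theta)$ buying from firm $i$ has utility, up to a reservation value that is the same for both firms, $u_i=\theta q_i-p_i-t(1-\xi_i)|x-e_i|$, where $q_i\ge0$, $p_i\ge0$ and $\xi_i\in[0,1]$ are firm $i$'s quality, price and XAI level. The reservation value is large enough that every customer makes exactly one purchase, from the firm giving the higher utility. Without loss of generality $q_1\ge q_2$. The market is explanation-dominated (market E) if for every $\theta\in[0,1]$ there is a customer $(x,\theta)$ who is indifferent between the two firms; customers to the left of the indifference line buy from firm 1 and those to the right from firm 2. The demand $d_i$ is the area of the set of customers buying from firm $i$, so $d_1+d_2=1$, and profit is $\pi_i=p_id_i-\beta q_i^2$; offering XAI costs nothing. Unregulated market: there is no policy-maker, and the firms play a three-stage game with common-knowledge payoffs $\pi_1,\pi_2$. Stage 0: firms simultaneously and freely choose XAI levels $\xi_1,\xi_2\in[0,1]$. Stage 1: firms simultaneously choose qualities $q_1,q_2$. Stage 2: firms simultaneously choose prices $p_1,p_2$. Equilibrium means pure-strategy Nash equilibrium obtained by backward induction (stage-2 equilibrium prices are substituted into the profits to find stage-1 equilibrium qualities, and these are substituted to find the stage-0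 equilibrium XAI levels).
   Formalization: Added: after XAI choices with several stage-1 quality equilibria, an explanation-dominated one is played wherever it exists; with arbitrary selection the claim fails, e.g. 18βt=1.55, 1−ξ=(0.99,1), where deviators are punished by equilibria outside market E. *)

theory Defs
  imports "HOL-Analysis.Analysis"
begin

datatype firm = Firm1 | Firm2

fun rival :: "firm \<Rightarrow> firm" where
  "rival Firm1 = Firm2"
| "rival Firm2 = Firm1"

fun location :: "firm \<Rightarrow> real" where
  "location Firm1 = 0"
| "location Firm2 = 1"

text \<open>
  A profile assigns a number (XAI level, quality or price) to each firm. The variables
  \<open>\<xi>\<close>, \<open>q\<close>, \<open>p\<close> stand for XAI, quality and price profiles, and a customer is a pair
  \<open>(x, \<theta>)\<close> of a position and a taste for quality.
\<close>

type_synonym profile = "firm \<Rightarrow> real"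

definition customers :: "(real \<times> real) set" where
  "customers = {0..1} \<times> {0..1}"

text \<open>The reservation value is the same for both firms and every customer buys exactly once,
  so it is left out of the utility.\<close>

definition utility ::
    "real \<Rightarrow> profile \<Rightarrow> profile \<Rightarrow> profile \<Rightarrow> firm \<Rightarrow> real \<times> real \<Rightarrow> real" where
  "utility t \<xi> q p i = (\<lambda>(x, \<theta>). \<theta> * q i - p i - t * (1 - \<xi> i) * \<bar>x - location i\<bar>)"

text \<open>
  Indifferent customers form a null set unless the misfit terms vanish
  (\<open>\<xi> Firm1 = \<xi> Firm2 = 1\<close>) and the qualities and the prices coincide. They are shared
  equally, so that the two demands always add up to 1 and the firms are treated alike.
\<close>

definition demand :: "real \<Rightarrow> profile \<Rightarrow> profile \<Rightarrow> profile \<Rightarrow> firm \<Rightarrow> real" where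
  "demand t \<xi> q p i =
     measure lborel {c \<in> customers. utility t \<xi> q p i c > utility t \<xi> q p (rival i) c}
   + measure lborel {c \<in> customers. utility t \<xi> q p i c = utility t \<xi> q p (rival i) c} / 2"

definition profit :: "real \<Rightarrow> real \<Rightarrow> profile \<Rightarrow> profile \<Rightarrow> profile \<Rightarrow> firm \<Rightarrow> real" where
  "profit \<beta> t \<xi> q p i = p i * demand t \<xi> q p i - \<beta> * (q i)\<^sup>2"

definition explanation_dominated :: "real \<Rightarrow> profile \<Rightarrow> profile \<Rightarrow> profile \<Rightarrow> bool" where
  "explanation_dominated t \<xi> q p \<longleftrightarrow>
     (\<forall>\<theta>\<in>{0..1}. \<exists>x\<in>{0..1}. utility t \<xi> q p Firm1 (x, \<theta>) = utility t \<xi> q p Firm2 (x, \<theta>))"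

definition nash :: "real set \<Rightarrow> (profile \<Rightarrow> firm \<Rightarrow> real) \<Rightarrow> profile \<Rightarrow> bool" where
  "nash A payoff s \<longleftrightarrow>
     (\<forall>i. s i \<in> A) \<and> (\<forall>i. \<forall>a\<in>A. payoff (s(i := a)) i \<le> payoff s i)"

text \<open>
  A price rule \<open>P\<close> maps XAI levels and qualities to prices; a quality rule \<open>Q\<close> maps XAI
  levels to qualities. They describe the play of the later stages in every subgame,
  on and off the equilibrium path.
\<close>

definition price_rule :: "real \<Rightarrow> real \<Rightarrow> (profile \<Rightarrow> profile \<Rightarrow> profile) \<Rightarrow> bool" where
  "price_rule \<beta> t P \<longleftrightarrow>
     (\<forall>\<xi> q. (\<forall>i. \<xi> i \<in> {0..1}) \<longrightarrow> (\<forall>i. q i \<in> {0..}) \<longrightarrow>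
        nash {0..} (profit \<beta> t \<xi> q) (P \<xi> q))"

definition quality_equilibrium ::
    "real \<Rightarrow> real \<Rightarrow> (profile \<Rightarrow> profile \<Rightarrow> profile) \<Rightarrow> profile \<Rightarrow> profile \<Rightarrow> bool" where
  "quality_equilibrium \<beta> t P \<xi> q \<longleftrightarrow> nash {0..} (\<lambda>q'. profit \<beta> t \<xi> q' (P \<xi> q')) q"

definition quality_rule ::
    "real \<Rightarrow> real \<Rightarrow> (profile \<Rightarrow> profile \<Rightarrow> profile) \<Rightarrow> (profile \<Rightarrow> profile) \<Rightarrow> bool" where
  "quality_rule \<beta> t P Q \<longleftrightarrow>
     (\<forall>\<xi>. (\<forall>i. \<xi> i \<in> {0..1}) \<longrightarrow> quality_equilibrium \<beta> t P \<xi> (Q \<xi>))"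

definition equilibrium ::
    "real \<Rightarrow> real \<Rightarrow> profile \<Rightarrow> (profile \<Rightarrow> profile) \<Rightarrow> (profile \<Rightarrow> profile \<Rightarrow> profile) \<Rightarrow> bool"
  where
  "equilibrium \<beta> t \<xi> Q P \<longleftrightarrow>
     price_rule \<beta> t P \<and> quality_rule \<beta> t P Q \<and>
     nash {0..1} (\<lambda>\<xi>'. profit \<beta> t \<xi>' (Q \<xi>') (P \<xi>' (Q \<xi>'))) \<xi>"

text \<open>
  After some XAI choices the quality stage has several equilibria: one in the
  explanation-dominated market and others outside it, in which one of the firms holds a
  much higher quality. For the analysis of the explanation-dominated market, the
  equilibrium substituted into stage 0 is the explanation-dominated one wherever it
  exists. Where there is none, any equilibrium of the quality stage may be played.
\<close>

definition explanation_dominated_selection ::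
    "real \<Rightarrow> real \<Rightarrow> (profile \<Rightarrow> profile) \<Rightarrow> (profile \<Rightarrow> profile \<Rightarrow> profile) \<Rightarrow> bool" where
  "explanation_dominated_selection \<beta> t Q P \<longleftrightarrow>
     (\<forall>\<xi>. (\<forall>i. \<xi> i \<in> {0..1}) \<longrightarrow>
        (\<exists>q. quality_equilibrium \<beta> t P \<xi> q \<and> explanation_dominated t \<xi> q (P \<xi> q)) \<longrightarrow>
        explanation_dominated t \<xi> (Q \<xi>) (P \<xi> (Q \<xi>)))"

end

theory Submission
  imports Defs
begin

text \<open>
  Write \<open>v\<^sub>i = 18 * \<beta> * t * (1 - \<xi>\<^sub>i)\<close> for the scaled misfit costs, \<open>u = v\<^sub>1 + v\<^sub>2\<close>, and
  measure profits in units of \<open>1 / (18 * \<beta>)\<close>. The price equilibrium is unique, so revenues are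
  functions of the quality gap. In an explanation-dominated equilibrium with \<open>q\<^sub>1 \<ge> q\<^sub>2\<close> and
  \<open>v\<^sub>1 \<noteq> v\<^sub>2\<close>, one of two deviations at stage 0 pays. Either the profit of firm 2 is at most
  \<open>3 / 8\<close> and \<open>v\<^sub>1 \<le> 2\<close>; then firm 2 switches to full explanation, after which every equilibrium
  of the quality stage, whatever its market type, gives it more than \<open>3 / 8\<close>. Or \<open>u > 2\<close> and firm 1
  earns less than \<open>v\<^sub>2 / 2 - 1 / 8\<close>; then it copies the XAI level of firm 2. The symmetric subgame
  with \<open>v\<^sub>2 > 1\<close> has an explanation-dominated equilibrium, which is therefore the one played, and
  there each firm earns exactly \<open>v\<^sub>2 / 2 - 1 / 8\<close>.
\<close>

section \<open>Demand as an area\<close>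

text \<open>A subgame may have several quality equilibria, so a deviation at stage 0 has to pay
  under every continuation that can be played. Off-path equilibria are therefore bounded by
  comparison with a few explicit deviations instead of being computed. The bound
  \<open>3 / 8\<close> is the value at u = 2 of (2u - 1) / 8, which bounds the profit of firm 2 for
  u between 1/2 and 2. Full explanation guarantees that firm at least 5/12, an estimate that uses
  \<open>v\<^sub>1 \<le> 2\<close>. In the symmetric subgame the first-order condition reads q =
  3/2, whence the revenue \<open>v\<^sub>2 / 2\<close> and the cost (3/2)^2 / 18 = 1/8. Two
  obstacles shape the argument. Demand is only piecewise smooth, because the indifference line may
  leave the square. And the explanation-dominated regime is a closed range of quality gaps, so an
  equilibrium may sit at its edge, where only a one-sided first-order condition is available; this
  is why inequalities replace equations in much of the quality stage.\<close>

definition clip :: "real \<Rightarrow> real" where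
  "clip y = max 0 (min 1 y)"

text \<open>The antiderivative of \<open>\<lambda>y. clip (y / u)\<close> that vanishes for negative
  \<open>y\<close>. Written with positive parts it is one formula across both kinks.\<close>

definition ramp_integral :: "real \<Rightarrow> real \<Rightarrow> real" where
  "ramp_integral u y = ((max 0 y)\<^sup>2 - (max 0 (y - u))\<^sup>2) / (2 * u)"

text \<open>Demand depends on the profiles only through the total misfit cost \<open>u\<close>, the
  quality gap \<open>D\<close> and the intercept \<open>z\<close>: the indifference line is u x =
  \<theta> D + z. Ties are split equally as in \<open>demand\<close>.\<close>

definition share :: "real \<Rightarrow> real \<Rightarrow> real \<Rightarrow> real" where
  "share u D z = measure lborel {c \<in> customers. u * fst c < snd c * D + z}
     + measure lborel {c \<in> customers. u * fst c = snd c * D + z} / 2"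

section \<open>Calculus of the clipped ramp\<close>

lemma DERIV_max_sq: "((\<lambda>y::real. (max 0 y)\<^sup>2) has_real_derivative 2 * max 0 y) (at y)"
proof -
  consider "y < 0" | "y > 0" | "y = 0" by linarith
  then show ?thesis
  proof cases
    case 1
    have "((\<lambda>y::real. 0) has_real_derivative 0) (at y)" by simp
    then show ?thesis
      by (rule has_field_derivative_transform_within_open[where S = "{..<0}", THEN DERIV_cong])
        (use 1 in auto)
  next
    case 2
    have "((\<lambda>y::real. y\<^sup>2) has_real_derivative 2 * y) (at y)"
      by (auto intro!: derivative_eq_intros)
    then show ?thesis
      by (rule has_field_derivative_transform_within_open[where S = "{0<..}", THEN DERIV_cong])
        (use 2 in auto)
  next
    case 3
    have "((\<lambda>h::real. (max 0 h)\<^sup>2 / h) \<longlongrightarrow> 0) (at 0)"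
    proof (rule tendsto_sandwich[where f = "\<lambda>h. 0 - \<bar>h\<bar>" and h = "\<lambda>h. \<bar>h\<bar>"])
      have "0 - \<bar>h\<bar> \<le> (max 0 h)\<^sup>2 / h \<and> (max 0 h)\<^sup>2 / h \<le> \<bar>h\<bar>" for h :: real
        by (auto simp: max_def power2_eq_square)
      then show "\<forall>\<^sub>F h::real in at 0. 0 - \<bar>h\<bar> \<le> (max 0 h)\<^sup>2 / h"
        "\<forall>\<^sub>F h::real in at 0. (max 0 h)\<^sup>2 / h \<le> \<bar>h\<bar>"
        by simp_all
    qed (auto intro!: tendsto_eq_intros)
    then show ?thesis using 3 by (simp add: DERIV_def)
  qed
qed

lemma DERIV_ramp_integral:
  assumes "u > 0"
  shows "(ramp_integral u has_real_derivative clip (y / u)) (at y)"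
proof -
  have "((\<lambda>y. (max 0 (y - u))\<^sup>2) has_real_derivative 2 * max 0 (y - u) * 1) (at y)"
    by (rule DERIV_chain2[where f = "\<lambda>y. (max 0 y)\<^sup>2" and g = "\<lambda>y. y - u"])
      (auto intro!: DERIV_max_sq derivative_eq_intros)
  then have "(ramp_integral u has_real_derivative (2 * max 0 y - 2 * max 0 (y - u)) / (2 * u)) (at y)"
    unfolding ramp_integral_def[abs_def]
    by (intro DERIV_cdivide DERIV_diff DERIV_max_sq) simp
  moreover have "(2 * max 0 y - 2 * max 0 (y - u)) / (2 * u) = clip (y / u)"
    using assms by (auto simp: clip_def max_def min_def field_simps)
  ultimately show ?thesis by simp
qed

text \<open>Integrated form of clip (1 - y / u) = 1 - clip (y / u). It expresses the exchange of the
  two firms.\<close>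

lemma ramp_integral_reflect:
  assumes "u > 0"
  shows "ramp_integral u (u - y) = ramp_integral u y + u / 2 - y"
  using assms by (auto simp: ramp_integral_def max_def field_simps power2_eq_square)

section \<open>Areas by slicing at fixed taste\<close>

lemma sets_customers [measurable]: "customers \<in> sets borel"
  unfolding customers_def by (intro borel_closed closed_Times) auto

lemma share_sets [measurable]:
  "{c \<in> customers. u * fst c < snd c * D + z} \<in> sets borel"
  "{c \<in> customers. u * fst c = snd c * D + z} \<in> sets borel"
proof -
  have "open {c :: real \<times> real. u * fst c < snd c * D + z}"
    "closed {c :: real \<times> real. u * fst c = snd c * D + z}"
    by (intro open_Collect_less closed_Collect_eq continuous_intros)+
  then have "customers \<inter> {c. u * fst c < snd c * D + z} \<in> sets borel"
    "customers \<inter> {c. u * fst c = snd c * D + z} \<in> sets borel"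
    by (simp_all add: borel_open borel_closed sets.Int sets_customers)
  then show "{c \<in> customers. u * fst c < snd c * D + z} \<in> sets borel"
    "{c \<in> customers. u * fst c = snd c * D + z} \<in> sets borel"
    by (simp_all add: Collect_conj_eq)
qed

lemma emeasure_customers_slices:
  assumes "S \<in> sets borel" "S \<subseteq> customers"
    and "\<And>\<theta>. \<theta> \<in> {0..1} \<Longrightarrow> emeasure lborel {x. (x, \<theta>) \<in> S} = ennreal (g \<theta>)"
  shows "emeasure lborel S = (\<integral>\<^sup>+\<theta>. ennreal (g \<theta>) * indicator {0..1} \<theta> \<partial>lborel)"
proof -
  have "S \<in> sets (lborel \<Otimes>\<^sub>M lborel)" using assms(1) unfolding lborel_prod by simp
  then have "emeasure (lborel \<Otimes>\<^sub>M lborel) S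
      = (\<integral>\<^sup>+\<theta>. emeasure lborel ((\<lambda>x. (x, \<theta>)) -` S) \<partial>lborel)"
    by (rule lborel_pair.emeasure_pair_measure_alt2)
  also have "\<dots> = (\<integral>\<^sup>+\<theta>. ennreal (g \<theta>) * indicator {0..1} \<theta> \<partial>lborel)"
  proof (rule nn_integral_cong)
    fix \<theta> :: real
    have "(\<lambda>x. (x, \<theta>)) -` S = (if \<theta> \<in> {0..1} then {x. (x, \<theta>) \<in> S} else {})"
      using assms(2) by (auto simp: customers_def)
    then show "emeasure lborel ((\<lambda>x. (x, \<theta>)) -` S) = ennreal (g \<theta>) * indicator {0..1} \<theta>"
      using assms(3) by simp
  qed
  finally show ?thesis by (simp add: lborel_prod)
qed

lemma measure_tie:
  assumes "u > 0"
  shows "measure lborel {c \<in> customers. u * fst c = snd c * D + z} = 0"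
proof -
  let ?S = "{c \<in> customers. u * fst c = snd c * D + z}"
  have "emeasure lborel ?S = (\<integral>\<^sup>+\<theta>. ennreal 0 * indicator {0..1::real} \<theta> \<partial>lborel)"
  proof (rule emeasure_customers_slices[where g = "\<lambda>_. 0"])
    fix \<theta> :: real
    have "{x. (x, \<theta>) \<in> ?S} \<subseteq> {(\<theta> * D + z) / u}"
      using assms by (auto simp: field_simps)
    then have "emeasure lborel {x. (x, \<theta>) \<in> ?S} \<le> emeasure lborel {(\<theta> * D + z) / u}"
      by (rule emeasure_mono) simp
    then show "emeasure lborel {x. (x, \<theta>) \<in> ?S} = ennreal 0"
      by simp
  qed (use share_sets(2) in blast)+
  then show ?thesis by (simp add: measure_def)
qed

lemma emeasure_slice:
  assumes "u > 0" "\<theta> \<in> {0..1}"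
  shows "emeasure lborel {x. (x, \<theta>) \<in> {c \<in> customers. u * fst c < snd c * D + z}}
    = ennreal (clip ((\<theta> * D + z) / u))"
proof -
  let ?y = "(\<theta> * D + z) / u"
  have *: "{x. (x, \<theta>) \<in> {c \<in> customers. u * fst c < snd c * D + z}} = {x \<in> {0..1}. x < ?y}"
    using assms by (auto simp: customers_def field_simps)
  consider "?y \<le> 0" | "0 < ?y" "?y \<le> 1" | "1 < ?y" by linarith
  then show ?thesis
  proof cases
    case 1
    then have empty: "{x \<in> {0..1}. x < ?y} = {}" by auto
    show ?thesis unfolding * empty using 1 by (simp add: clip_def)
  next
    case 2
    then have ico: "{x \<in> {0..1}. x < ?y} = {0..<?y}" by auto
    show ?thesis unfolding * ico using 2 by (simp add: clip_def)
  next
    case 3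
    then have icc: "{x \<in> {0..1}. x < ?y} = {0..1}" by auto
    show ?thesis unfolding * icc using 3 by (simp add: clip_def)
  qed
qed

text \<open>The slice at taste \<theta> has length \<open>clip ((\<theta> * D + z) / u)\<close>,
  with antiderivative \<open>ramp_integral u (\<theta> * D + z) / D\<close> in \<theta>.\<close>

lemma share_eq:
  assumes "u > 0" "D \<noteq> 0"
  shows "share u D z = (ramp_integral u (D + z) - ramp_integral u z) / D"
proof -
  have "emeasure lborel {c \<in> customers. u * fst c < snd c * D + z}
     = (\<integral>\<^sup>+\<theta>. ennreal (clip ((\<theta> * D + z) / u)) * indicator {0..1} \<theta> \<partial>lborel)"
    by (rule emeasure_customers_slices) (use assms emeasure_slice share_sets in auto)
  also have "\<dots> = ennreal (ramp_integral u (1 * D + z) / D - ramp_integral u (0 * D + z) / D)"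
  proof (rule nn_integral_FTC_Icc)
    fix \<theta> :: real
    show "((\<lambda>\<theta>. ramp_integral u (\<theta> * D + z) / D) has_real_derivative clip ((\<theta> * D + z) / u)) (at \<theta>)"
    proof -
      have "((\<lambda>\<theta>. ramp_integral u (\<theta> * D + z)) has_real_derivative clip ((\<theta> * D + z) / u) * D) (at \<theta>)"
        by (rule DERIV_chain2[where f = "ramp_integral u" and g = "\<lambda>\<theta>. \<theta> * D + z"])
          (auto intro!: DERIV_ramp_integral derivative_eq_intros assms)
      from DERIV_cdivide[OF this, of D] show ?thesis
        using assms by simp
    qed
  qed (auto simp: clip_def)
  finally have *: "emeasure lborel {c \<in> customers. u * fst c < snd c * D + z}
     = ennreal ((ramp_integral u (D + z) - ramp_integral u z) / D)"
    by (simp add: diff_divide_distrib)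
  have "0 \<le> (ramp_integral u (D + z) - ramp_integral u z) / D"
  proof -
    have mono: "ramp_integral u x \<le> ramp_integral u y" if "x \<le> y" for x y
      by (rule DERIV_nonneg_imp_nondecreasing[OF that])
        (use DERIV_ramp_integral[OF assms(1)] in \<open>force simp: clip_def\<close>)
    show ?thesis using mono[of z "D + z"] mono[of "D + z" z] assms(2)
      by (cases "D > 0") (auto simp: divide_simps)
  qed
  then show ?thesis
    unfolding share_def measure_tie[OF assms(1)] by (simp add: measure_def *)
qed

lemma share_gap_zero:
  assumes "u > 0"
  shows "share u 0 z = clip (z / u)"
proof -
  have "emeasure lborel {c \<in> customers. u * fst c < snd c * 0 + z}
     = (\<integral>\<^sup>+\<theta>. ennreal (clip (z / u)) * indicator {0..1::real} \<theta> \<partial>lborel)"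
    by (rule emeasure_customers_slices[where g = "\<lambda>_. clip (z / u)"])
      (use assms emeasure_slice[of u _ 0 z] share_sets[of u 0 z] in auto)
  also have "\<dots> = ennreal (clip (z / u))"
    by (simp add: nn_integral_cmult)
  finally show ?thesis
    unfolding share_def measure_tie[OF assms(1)] by (simp add: measure_def clip_def)
qed

lemma measure_box: "measure lborel {c \<in> customers. snd c \<in> B} = measure lborel ({0..1} \<inter> B)"
  if "B \<in> sets borel" for B :: "real set"
proof -
  have "{c \<in> customers. snd c \<in> B} = {0..1} \<times> ({0..1} \<inter> B)" by (auto simp: customers_def)
  moreover have "emeasure lborel ({0..1::real} \<times> ({0..1} \<inter> B)) = emeasure lborel {0..1::real} * emeasure lborel ({0..1} \<inter> B)"
    unfolding lborel_prod[symmetric] by (rule lborel.emeasure_pair_measure_Times) (use that in auto)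
  ultimately show ?thesis by (simp add: measure_def)
qed

lemma share_misfit_zero:
  "share 0 D z = measure lborel ({0..1} \<inter> {\<theta>. 0 < \<theta> * D + z})
     + measure lborel ({0..1} \<inter> {\<theta>. 0 = \<theta> * D + z}) / 2"
  using measure_box[of "{\<theta>. 0 < \<theta> * D + z}"] measure_box[of "{\<theta>. 0 = \<theta> * D + z}"]
  by (simp add: share_def)

text \<open>Without misfit costs only the taste matters, and the customers with \<theta> > - z / D
  choose the better product. The form \<open>clip ((D + z) / D)\<close> is chosen to match the case
  of equal qualities, so that both can be treated together at the price stage.\<close>

lemma share_misfit_zero_gap_pos:
  assumes "D > 0"
  shows "share 0 D z = clip ((D + z) / D)"
proof -
  have "{0..1} \<inter> {\<theta>. 0 = \<theta> * D + z} \<subseteq> {- z / D}"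
    using assms by (auto simp: field_simps)
  then have "emeasure lborel ({0..1} \<inter> {\<theta>. 0 = \<theta> * D + z}) \<le> emeasure lborel {- z / D}"
    by (rule emeasure_mono) simp
  then have tie: "measure lborel ({0..1} \<inter> {\<theta>. 0 = \<theta> * D + z}) = 0"
    by (simp add: measure_def)
  have eq: "{0..1} \<inter> {\<theta>. 0 < \<theta> * D + z} = {\<theta> \<in> {0..1}. - z / D < \<theta>}"
    using assms by (auto simp: field_simps)
  consider "- z / D < 0" | "0 \<le> - z / D" "- z / D < 1" | "1 \<le> - z / D" by linarith
  then have "measure lborel {\<theta> \<in> {0..1}. - z / D < \<theta>} = clip (1 - (- z / D))"
  proof cases
    case 1
    then have "{\<theta> \<in> {0..1}. - z / D < \<theta>} = {0..1}" by auto
    then show ?thesis using 1 by (simp add: clip_def)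
  next
    case 2
    then have "{\<theta> \<in> {0..1}. - z / D < \<theta>} = {- z / D<..1}" by auto
    then show ?thesis using 2 by (simp add: clip_def)
  next
    case 3
    then have empty: "{\<theta> \<in> {0..1}. - z / D < \<theta>} = {}" by auto
    show ?thesis unfolding empty using 3 by (simp add: clip_def)
  qed
  then show ?thesis unfolding share_misfit_zero eq tie using assms by (simp add: field_simps)
qed

lemma measure_partition:
  fixes f :: "'a::euclidean_space \<Rightarrow> real"
  assumes [measurable]: "f \<in> borel_measurable borel" "A \<in> sets borel"
    and fin: "emeasure lborel A \<noteq> \<infinity>"
  shows "measure lborel {c \<in> A. 0 < f c} + measure lborel {c \<in> A. 0 = f c}
    + measure lborel {c \<in> A. f c < 0} = measure lborel A"
proof -
  have fm: "emeasure lborel {c \<in> A. P c} \<noteq> \<infinity>" for P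
  proof -
    have "emeasure lborel {c \<in> A. P c} \<le> emeasure lborel A" by (rule emeasure_mono) auto
    then show ?thesis using fin by (auto simp: top_unique)
  qed
  have "measure lborel ({c \<in> A. 0 < f c} \<union> {c \<in> A. 0 = f c}) =
      measure lborel {c \<in> A. 0 < f c} + measure lborel {c \<in> A. 0 = f c}"
    by (rule measure_Union) (use fm in \<open>auto\<close>)
  moreover have "measure lborel (({c \<in> A. 0 < f c} \<union> {c \<in> A. 0 = f c}) \<union> {c \<in> A. f c < 0}) =
      measure lborel ({c \<in> A. 0 < f c} \<union> {c \<in> A. 0 = f c}) + measure lborel {c \<in> A. f c < 0}"
    by (rule measure_Union) (use fm in \<open>auto simp flip: Collect_disj_eq conj_disj_distribL\<close>)
  moreover have "({c \<in> A. 0 < f c} \<union> {c \<in> A. 0 = f c}) \<union> {c \<in> A. f c < 0} = A" by auto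
  ultimately show ?thesis by simp
qed

text \<open>Mirroring the line by x to 1 - x exchanges the firms: the rival sees the gap
  \<open>- D\<close> and the intercept \<open>u - z\<close>. For \<open>u = 0\<close> ties can have
  positive measure, and the equal split keeps the sum of the shares at 1.\<close>

lemma share_reflect:
  assumes "u \<ge> 0"
  shows "share u (- D) (u - z) = 1 - share u D z"
proof (cases "u = 0")
  case True
  have "measure lborel {\<theta> \<in> {0..1}. 0 < \<theta> * D + z} + measure lborel {\<theta> \<in> {0..1}. 0 = \<theta> * D + z}
    + measure lborel {\<theta> \<in> {0..1}. \<theta> * D + z < 0} = measure lborel {0..1::real}"
    by (rule measure_partition) auto
  moreover have "{0..1} \<inter> {\<theta>. 0 < \<theta> * (- D) + - z} = {\<theta> \<in> {0..1}. \<theta> * D + z < 0}"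
    "{0..1} \<inter> {\<theta>. 0 = \<theta> * (- D) + - z} = {\<theta> \<in> {0..1}. 0 = \<theta> * D + z}"
    "{0..1} \<inter> {\<theta>. 0 = \<theta> * D + z} = {\<theta> \<in> {0..1}. 0 = \<theta> * D + z}"
    "{0..1} \<inter> {\<theta>. 0 < \<theta> * D + z} = {\<theta> \<in> {0..1}. 0 < \<theta> * D + z}"
    by auto
  ultimately show ?thesis unfolding True diff_0 share_misfit_zero by (simp)
next
  case False
  then have u: "u > 0" using assms by simp
  show ?thesis
  proof (cases "D = 0")
    case True
    have "clip (1 - z / u) = 1 - clip (z / u)" by (auto simp: clip_def)
    then show ?thesis using True u by (simp add: share_gap_zero diff_divide_distrib)
  next
    case False
    have "share u (- D) (u - z) = (ramp_integral u (u - (D + z)) - ramp_integral u (u - z)) / (- D)"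
      using False u by (simp add: share_eq algebra_simps)
    also have "\<dots> = 1 - (ramp_integral u (D + z) - ramp_integral u z) / D"
      using False unfolding ramp_integral_reflect[OF u] by (simp add: field_simps)
    finally show ?thesis using False u by (simp add: share_eq)
  qed
qed

section \<open>Symmetry between the firms\<close>

lemma rival_rival [simp]: "rival (rival i) = i" by (cases i) auto
lemma rival_neq [simp]: "rival i \<noteq> i" "i \<noteq> rival i" by (cases i; simp)+

lemma demand_rival: "demand t \<xi> q p (rival i) = 1 - demand t \<xi> q p i"
proof -
  let ?f = "\<lambda>c. utility t \<xi> q p i c - utility t \<xi> q p (rival i) c"
  have [measurable]: "utility t \<xi> q p i \<in> borel_measurable borel" for i
    unfolding utility_def case_prod_beta'
    by (intro borel_measurable_continuous_onI continuous_intros)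
  have "emeasure lborel customers = emeasure lborel {0..1::real} * emeasure lborel {0..1::real}"
    unfolding customers_def lborel_prod[symmetric] by (rule lborel.emeasure_pair_measure_Times) auto
  then have one: "emeasure lborel customers = 1" by simp
  have "measure lborel {c \<in> customers. 0 < ?f c} + measure lborel {c \<in> customers. 0 = ?f c}
    + measure lborel {c \<in> customers. ?f c < 0} = measure lborel customers"
    by (rule measure_partition) (use one in auto)
  moreover have "{c \<in> customers. 0 = ?f c} = {c \<in> customers. utility t \<xi> q p i c = utility t \<xi> q p (rival i) c}"
    "{c \<in> customers. utility t \<xi> q p (rival i) c = utility t \<xi> q p i c} = {c \<in> customers. utility t \<xi> q p i c = utility t \<xi> q p (rival i) c}"
    by auto
  ultimately show ?thesis using one by (simp add: demand_def measure_def)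
qed

text \<open>For \<open>Firm1\<close> this rearranges the comparison of utilities;
  \<open>Firm2\<close> follows by reflection. Since the formula is the same for both, later
  arguments can speak of the firm with the higher quality instead of \<open>Firm1\<close>.\<close>

lemma demand_eq_share:
  assumes "\<And>i. c i = t * (1 - \<xi> i)" "c i + c (rival i) \<ge> 0"
  shows "demand t \<xi> q p i = share (c i + c (rival i)) (q i - q (rival i)) (p (rival i) - p i + c (rival i))"
proof -
  have 1: "demand t \<xi> q p Firm1 = share (c Firm1 + c Firm2) (q Firm1 - q Firm2) (p Firm2 - p Firm1 + c Firm2)"
  proof -
    have "{c \<in> customers. utility t \<xi> q p Firm1 c > utility t \<xi> q p Firm2 c} =
      {x \<in> customers. (c Firm1 + c Firm2) * fst x < snd x * (q Firm1 - q Firm2) + (p Firm2 - p Firm1 + c Firm2)}"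
     "{c \<in> customers. utility t \<xi> q p Firm1 c = utility t \<xi> q p Firm2 c} =
      {x \<in> customers. (c Firm1 + c Firm2) * fst x = snd x * (q Firm1 - q Firm2) + (p Firm2 - p Firm1 + c Firm2)}"
      by (auto simp: customers_def utility_def assms(1) algebra_simps)
    then show ?thesis by (simp add: demand_def share_def)
  qed
  show ?thesis
  proof (cases i)
    case Firm1
    then show ?thesis using 1 by simp
  next
    case Firm2
    have "demand t \<xi> q p Firm2 = 1 - demand t \<xi> q p Firm1" using demand_rival[of t \<xi> q p Firm1] by simp
    also have "\<dots> = share (c Firm1 + c Firm2) (- (q Firm1 - q Firm2)) (c Firm1 + c Firm2 - (p Firm2 - p Firm1 + c Firm2))"
      unfolding 1 by (rule share_reflect[symmetric]) (use assms(2) Firm2 in simp)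
    finally show ?thesis using Firm2 by (simp add: algebra_simps)
  qed
qed

section \<open>Price stage\<close>

lemma ramp_integral_simps:
  assumes "u > 0"
  shows "y \<le> 0 \<Longrightarrow> ramp_integral u y = 0"
    and "0 \<le> y \<Longrightarrow> y \<le> u \<Longrightarrow> ramp_integral u y = y\<^sup>2 / (2 * u)"
    and "u \<le> y \<Longrightarrow> ramp_integral u y = y - u / 2"
  using assms by (auto simp: ramp_integral_def max_def power2_eq_square field_simps)

lemma clip_divide_simps:
  assumes "u > 0"
  shows "y \<le> 0 \<Longrightarrow> clip (y / u) = 0"
    and "0 \<le> y \<Longrightarrow> y \<le> u \<Longrightarrow> clip (y / u) = y / u"
    and "u \<le> y \<Longrightarrow> clip (y / u) = 1"
  using assms by (auto simp: clip_def field_simps)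

lemma ramp_integral_less:
  assumes "u > 0" "x < y" "0 < y"
  shows "ramp_integral u x < ramp_integral u y"
proof -
  have "ramp_integral u x = ramp_integral u (max 0 x)"
    using assms by (auto simp: max_def ramp_integral_simps)
  also have "\<dots> < ramp_integral u y"
  proof (rule DERIV_pos_imp_increasing_open[where f = "ramp_integral u"])
    show "\<exists>d. (ramp_integral u has_real_derivative d) (at v) \<and> 0 < d" if "max 0 x < v" "v < y" for v
      using DERIV_ramp_integral[OF assms(1), of v] that assms(1)
      by (intro exI[of _ "clip (v / u)"]) (auto simp: clip_def)
    show "continuous_on {max 0 x..y} (ramp_integral u)"
      using DERIV_ramp_integral[OF assms(1)] by (meson DERIV_continuous continuous_at_imp_continuous_on)
  qed (use assms in auto)
  finally show ?thesis .
qed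

text \<open>A firm with zero revenue could sell at any positive price below its choke price, so in
  equilibrium that choke price is not positive. This rules out corner solutions: both prices are
  positive, both firms sell, and the ordinary first-order conditions hold. Abstracting from
  \<open>F\<close> serves all shapes of demand at once.\<close>

lemma price_foc:
  fixes F f :: "real \<Rightarrow> real"
  assumes nn: "0 \<le> a" "0 \<le> b" "0 \<le> D" "0 < a + b + D" "0 \<le> X" "0 \<le> Y"
    and F0: "\<And>z. z \<le> - D \<Longrightarrow> F z = 0" and F1: "\<And>z. a + b \<le> z \<Longrightarrow> F z = 1"
    and pos: "\<And>z. - D < z \<Longrightarrow> 0 < F z" and less: "\<And>z. z < a + b \<Longrightarrow> F z < 1"
    and deriv: "\<And>z. - D < z \<Longrightarrow> z < a + b \<Longrightarrow> (F has_real_derivative f z) (at z)"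
    and bestX: "\<And>p. 0 \<le> p \<Longrightarrow> p * F (Y - p + b) \<le> X * F (Y - X + b)"
    and bestY: "\<And>p. 0 \<le> p \<Longrightarrow> p * (1 - F (p - X + b)) \<le> Y * (1 - F (Y - X + b))"
    and z: "z = Y - X + b"
  shows "- D < z" "z < a + b" "X * f z = F z" "Y * f z = 1 - F z"
proof -
  have zeroX: "Y + b + D \<le> 0" if "X * F z \<le> 0"
  proof (rule ccontr)
    assume *: "\<not> Y + b + D \<le> 0"
    \<comment> \<open>Half the choke price: demand \<open>F (Y - p + b)\<close> is positive exactly
      for p < Y + b + D. The rival's choke price is \<open>X + a\<close>.\<close>
    define p where "p = (Y + b + D) / 2"
    have "p > 0" "- D < Y - p + b" using * nn by (auto simp: p_def field_simps)
    with pos[of "Y - p + b"] bestX[of p] that z show False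
      by (smt (verit) mult_pos_pos)
  qed
  have zeroY: "X + a \<le> 0" if "Y * (1 - F z) \<le> 0"
  proof (rule ccontr)
    assume *: "\<not> X + a \<le> 0"
    define p where "p = (X + a) / 2"
    have "p > 0" "p - X + b < a + b" using * nn by (auto simp: p_def field_simps)
    with less[of "p - X + b"] bestY[of p] that z show False
      by (smt (verit) mult_pos_pos)
  qed
  show lo: "- D < z"
  proof (rule ccontr)
    assume "\<not> - D < z"
    with F0[of z] zeroX have "Y + b + D \<le> 0" by simp
    then have *: "Y = 0" "b = 0" "D = 0" using nn by auto
    then have "X + a \<le> 0" using zeroY by simp
    with * nn show False by simp
  qed
  show hi: "z < a + b"
  proof (rule ccontr)
    assume "\<not> z < a + b"
    with F1[of z] zeroY have "X + a \<le> 0" by simp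
    then have *: "X = 0" "a = 0" using nn by auto
    then have "Y + b + D \<le> 0" using zeroX by simp
    with * nn show False by simp
  qed
  have "X > 0" 
  proof (rule ccontr)
    assume "\<not> X > 0"
    then have "X = 0" using nn by simp
    with zeroX nn have "Y = 0" "b = 0" "D = 0" by auto
    with lo z \<open>X = 0\<close> show False by simp
  qed
  have "Y > 0" 
  proof (rule ccontr)
    assume "\<not> Y > 0"
    then have "Y = 0" using nn by simp
    with zeroY nn have "X = 0" by auto
    with \<open>X > 0\<close> show False by simp
  qed
  have dF: "(F has_real_derivative f z) (at z)" using deriv lo hi .
  have "((\<lambda>p. F (Y - p + b)) has_real_derivative f z * (- 1)) (at X)"
    by (rule DERIV_chain2[where f = F]) (use dF z in \<open>auto intro!: derivative_eq_intros\<close>)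
  then have "((\<lambda>p. p * F (Y - p + b)) has_real_derivative F z - X * f z) (at X)"
    using z by (auto intro!: derivative_eq_intros)
  then have "F z - X * f z = 0"
    by (rule DERIV_local_max[of _ _ _ X]) (use \<open>X > 0\<close> bestX in \<open>auto simp: abs_if split: if_splits\<close>)
  then show "X * f z = F z" by simp
  have "((\<lambda>p. F (p - X + b)) has_real_derivative f z * 1) (at Y)"
    by (rule DERIV_chain2[where f = F]) (use dF z in \<open>auto intro!: derivative_eq_intros\<close>)
  then have "((\<lambda>p. p * (1 - F (p - X + b))) has_real_derivative (1 - F z) - Y * f z) (at Y)"
    using z by (auto intro!: derivative_eq_intros)
  then have "(1 - F z) - Y * f z = 0"
    by (rule DERIV_local_max[of _ _ _ Y]) (use \<open>Y > 0\<close> bestY in \<open>auto simp: abs_if split: if_splits\<close>)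
  then show "Y * f z = 1 - F z" by simp
qed

text \<open>
  Price-stage revenues \<open>r\<close>, \<open>s\<close> of the firms with the higher and the lower quality, when
  their misfit costs are \<open>a\<close>, \<open>b\<close> and the quality gap is \<open>D\<close>. As \<open>D\<close> grows, the line of
  indifferent customers first leaves the square through the right-hand side and then through
  the left-hand side as well. In between, the equilibrium is
  parametrised by \<open>w = a + b - z\<close>, where \<open>z = p\<^sub>l - p\<^sub>h + b\<close>.
\<close>

definition revenues :: "real \<Rightarrow> real \<Rightarrow> real \<Rightarrow> real \<Rightarrow> real \<Rightarrow> bool" where
  "revenues a b D r s \<longleftrightarrow>
    (if a + b = 0 \<and> D = 0 then r = 0 \<and> s = 0
     else if 0 < a + b \<and> D \<le> a + b / 2 then
       r = (D / 2 + a + 2 * b)\<^sup>2 / (9 * (a + b)) \<and> s = (2 * a + b - D / 2)\<^sup>2 / (9 * (a + b))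
     else if a + 2 * b \<le> D then
       r = (2 * D + (b - a) / 2)\<^sup>2 / (9 * D) \<and> s = (D - (b - a) / 2)\<^sup>2 / (9 * D)
     else \<exists>w. a + b / 2 \<le> w \<and> w \<le> a + b \<and> D * (a + b) = w * (2 * w - a) \<and>
       r = (3 * w - 2 * a)\<^sup>2 / (4 * (2 * w - a)) \<and> s = w\<^sup>2 / (4 * (2 * w - a)))"

text \<open>Where demand has constant slope 1 / n, the first-order condition makes it X / n, and the
  equilibrium price \<open>X\<close> is a third of a linear expression.\<close>

lemma third_mult_third: "X = y / 3 \<Longrightarrow> X * (X / n) = y\<^sup>2 / (9 * n)" for X :: real
  by (simp only: power2_eq_square) simp

text \<open>If misfit or the quality gap vanishes, customers differ in one relevant dimension only,
  and demand is linear on an interval of length \<open>n\<close>.\<close>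

lemma revenues_clip:
  assumes "0 \<le> a" "0 \<le> b" "0 \<le> D" "0 \<le> X" "0 \<le> Y" "a + b = 0 \<or> D = 0"
    and n: "n = a + b + D" "0 < n"
    and F: "\<And>z. F z = clip ((z + D) / n)"
    and bestX: "\<And>p. 0 \<le> p \<Longrightarrow> p * F (Y - p + b) \<le> X * F (Y - X + b)"
    and bestY: "\<And>p. 0 \<le> p \<Longrightarrow> p * (1 - F (p - X + b)) \<le> Y * (1 - F (Y - X + b))"
    and z: "z = Y - X + b"
  shows "revenues a b D (X * F z) (Y * (1 - F z))"
    and "D = 0 \<Longrightarrow> 0 \<le> z \<and> z \<le> a + b"
proof -
  have deriv: "(F has_real_derivative 1 / n) (at x)" if "- D < x" "x < a + b" for x
  proof -
    have "((\<lambda>x. (x + D) / n) has_real_derivative 1 / n) (at x)"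
      using n by (auto intro!: derivative_eq_intros)
    then show ?thesis
      by (rule has_field_derivative_transform_within_open[where S = "{- D<..<a + b}"])
        (use that n in \<open>auto simp: F clip_def max_def min_def divide_simps\<close>)
  qed
  have foc: "- D < z" "z < a + b" "X * (1 / n) = F z" "Y * (1 / n) = 1 - F z"
    by (rule price_foc[where F = F and f = "\<lambda>_. 1 / n", OF assms(1-3) _ assms(4,5) _ _ _ _ deriv bestX bestY z];
      use n in \<open>auto simp: F clip_def max_def min_def divide_simps\<close>)+
  have Fz: "F z = (z + D) / n" using foc n by (auto simp: F clip_def max_def min_def divide_simps)
  have X: "X = z + D" and Y: "Y = n - z - D" using foc n unfolding Fz by (auto simp: field_simps)
  have "3 * z = n - 2 * D + b" using X Y z by linarith
  then have z': "z = (n - 2 * D + b) / 3" by simp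
  have F': "X * F z = X * (X / n)" "Y * (1 - F z) = Y * (Y / n)"
    using foc(3) by (simp, simp flip: foc(4))
  show "D = 0 \<Longrightarrow> 0 \<le> z \<and> z \<le> a + b" using foc by simp
  show "revenues a b D (X * F z) (Y * (1 - F z))"
  proof (cases "D = 0")
    case True
    then have XY: "X = (a + 2 * b) / 3" "Y = (2 * a + b) / 3"
      using X Y z' n(1) by (simp_all add: field_simps)
    show ?thesis
      using n True assms(1,2) unfolding F' third_mult_third[OF XY(1)] third_mult_third[OF XY(2)]
      by (simp add: revenues_def)
  next
    case False
    then have "a = 0" "b = 0" using assms by auto
    then have XY: "X = 2 * D / 3" "Y = D / 3"
      using X Y z' n(1) by (simp_all add: field_simps)
    show ?thesis
      using n assms(3) \<open>a = 0\<close> \<open>b = 0\<close>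
      unfolding F' third_mult_third[OF XY(1)] third_mult_third[OF XY(2)]
      by (simp add: revenues_def)
  qed
qed

lemma revenues_interior:
  assumes nn: "0 \<le> a" "0 \<le> b" "0 < D" "0 \<le> X" "0 \<le> Y" "u = a + b" "0 < u"
    and F: "\<And>z. F z = (ramp_integral u (D + z) - ramp_integral u z) / D"
    and bestX: "\<And>p. 0 \<le> p \<Longrightarrow> p * F (Y - p + b) \<le> X * F (Y - X + b)"
    and bestY: "\<And>p. 0 \<le> p \<Longrightarrow> p * (1 - F (p - X + b)) \<le> Y * (1 - F (Y - X + b))"
    and z: "z = Y - X + b"
  shows "revenues a b D (X * F z) (Y * (1 - F z))"
    and "0 \<le> z \<and> z + D \<le> u \<longleftrightarrow> D \<le> a + b / 2"
proof -
  define f where "f z = (clip ((D + z) / u) - clip (z / u)) / D" for z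
  have deriv: "(F has_real_derivative f x) (at x)" for x
  proof -
    have "((\<lambda>x. ramp_integral u (D + x)) has_real_derivative clip ((D + x) / u) * 1) (at x)"
      by (rule DERIV_chain2[where f = "ramp_integral u"])
        (auto intro!: DERIV_ramp_integral nn derivative_eq_intros)
    then show ?thesis unfolding F[abs_def] f_def using nn
      by (intro DERIV_cdivide DERIV_diff DERIV_ramp_integral) auto
  qed
  have refl: "1 - F x = (ramp_integral u (u - x) - ramp_integral u (u - x - D)) / D" for x
    using ramp_integral_reflect[OF nn(7), of x] ramp_integral_reflect[OF nn(7), of "x + D"] nn(3)
    by (simp add: F field_simps)
  have F0: "F x = 0" if "x \<le> - D" for x
    using that nn(3,7) by (simp add: F ramp_integral_simps(1))
  have F1: "F x = 1" if "a + b \<le> x" for x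
    using that nn(3,6,7) by (simp add: F ramp_integral_simps(3))
  have pos: "0 < F x" if "- D < x" for x
    using that nn(3,7) ramp_integral_less[of u x "D + x"] by (simp add: F)
  have less: "F x < 1" if "x < a + b" for x
  proof -
    have "0 < 1 - F x"
      unfolding refl using that nn(3,6,7) ramp_integral_less[of u "u - x - D" "u - x"] by simp
    then show ?thesis by simp
  qed
  have "0 \<le> D" "0 < a + b + D" using nn by auto
  note foc = price_foc[where F = F and f = f, OF nn(1,2) this nn(4,5) F0 F1 pos less deriv bestX bestY z]
  have "revenues a b D (X * F z) (Y * (1 - F z)) \<and> (0 \<le> z \<and> z + D \<le> u \<longleftrightarrow> D \<le> a + b / 2)"
  proof -
    \<comment> \<open>\<open>z\<close> and \<open>D + z\<close> are \<open>u\<close> times the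
      positions where the indifference line meets \<theta> = 0 and \<theta> = 1. The cases record
      which end lies beyond the sides x = 0 and x = 1.\<close>
    consider "z < 0" "D + z < u" | "0 \<le> z" "D + z \<le> u" | "z \<le> 0" "u \<le> D + z" "\<not> (0 \<le> z \<and> D + z \<le> u)"
      | "0 < z" "u < D + z"
      by linarith
    then show ?thesis
    proof cases
      case 1
      \<comment> \<open>The line would leave through the left-hand side only. This cannot happen in
        equilibrium: the first-order conditions give 2 y^2 = u D + b y + D y, but y^2 < u D and y^2
        \<le> D y.\<close>
      define y where "y = D + z"
      have y: "0 < y" "y < D" "y < u" using foc(1) 1 by (auto simp: y_def)
      have "F z = y\<^sup>2 / (2 * u * D)" "f z = y / (u * D)"
        using 1 y nn(7) unfolding F f_def
        by (simp_all add: ramp_integral_simps clip_divide_simps flip: y_def)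
      with foc have "X * y = y\<^sup>2 / 2" "Y * y = u * D - y\<^sup>2 / 2"
        using nn(3,7) by (auto simp: field_simps)
      then have "(Y - X + b - z) * y = u * D - y\<^sup>2 + b * y - (y - D) * y"
        by (simp add: algebra_simps y_def)
      then have "2 * (y * y) = u * D + b * y + D * y"
        using z by (simp add: algebra_simps power2_eq_square)
      moreover have "y * y < u * D" "y * y \<le> D * y" "0 \<le> b * y"
        using y nn(2) by (auto intro!: mult_strict_mono)
      ultimately show ?thesis by linarith
    next
      case 2
      have "F z = (2 * z + D) / (2 * u)" "f z = 1 / u"
        using 2 nn(3,7) foc unfolding F f_def
        by (simp_all add: ramp_integral_simps clip_divide_simps field_simps power2_eq_square)
      note Ff = this
      have F': "X * F z = X * (X / u)" "Y * (1 - F z) = Y * (Y / u)"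
        by (simp flip: foc(3) add: Ff(2), simp flip: foc(4) add: Ff(2))
      have XY: "X = z + D / 2" "Y = u - z - D / 2"
        using foc(3,4) nn(7) unfolding Ff by (auto simp: field_simps)
      have "3 * z = u + b - D" using XY z by linarith
      then have z': "z = (u + b - D) / 3" by simp
      have D: "D \<le> a + b / 2" using 2(2) z' nn(6) by (simp add: field_simps)
      have "X = (D / 2 + a + 2 * b) / 3" "Y = (2 * a + b - D / 2) / 3"
        using XY z' nn(6) by (simp_all add: field_simps)
      then have "X * F z = (D / 2 + a + 2 * b)\<^sup>2 / (9 * (a + b))"
        "Y * (1 - F z) = (2 * a + b - D / 2)\<^sup>2 / (9 * (a + b))"
        unfolding F' nn(6) by (blast intro: third_mult_third)+
      then show ?thesis using D 2 nn(3,6,7) by (simp add: revenues_def add.commute)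
    next
      case 3
      have "F z = (D + z - u / 2) / D" "f z = 1 / D"
        using 3 nn(3,7) foc unfolding F f_def
        by (simp_all add: ramp_integral_simps clip_divide_simps)
      note Ff = this
      have F': "X * F z = X * (X / D)" "Y * (1 - F z) = Y * (Y / D)"
        by (simp flip: foc(3) add: Ff(2), simp flip: foc(4) add: Ff(2))
      have XY: "X = D + z - u / 2" "Y = u / 2 - z"
        using foc(3,4) nn(3) unfolding Ff by (auto simp: field_simps)
      have "3 * z = u + b - D" using XY z by linarith
      then have z': "z = (u + b - D) / 3" by simp
      have D: "a + 2 * b \<le> D" "\<not> D \<le> a + b / 2" using 3 z' nn(1,2,6) by auto
      have "X = (2 * D + (b - a) / 2) / 3" "Y = (D - (b - a) / 2) / 3"
        using XY z' nn(6) by (simp_all add: field_simps)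
      then have "X * F z = (2 * D + (b - a) / 2)\<^sup>2 / (9 * D)"
        "Y * (1 - F z) = (D - (b - a) / 2)\<^sup>2 / (9 * D)"
        unfolding F' by (blast intro: third_mult_third)+
      then show ?thesis using D 3 nn(3,6,7) by (simp add: revenues_def add.commute)
    next
      case 4
      \<comment> \<open>The customers of the lower-quality firm form a right triangle with legs w /
        u and w / D, hence its share w^2 / (2 u D).\<close>
      define w where "w = u - z"
      have w: "0 < w" "w < u" "w < D" using 4 foc(2) nn by (auto simp: w_def)
      have Ff: "1 - F z = w\<^sup>2 / (2 * u * D)" "f z = w / (u * D)"
      proof -
        have "F z = (D + z - u / 2 - z\<^sup>2 / (2 * u)) / D" "f z = (1 - z / u) / D"
          using 4 nn(6,7) foc(2) unfolding F f_def
          by (simp_all add: ramp_integral_simps clip_divide_simps)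
        then show "1 - F z = w\<^sup>2 / (2 * u * D)" "f z = w / (u * D)"
          using nn(3,7) unfolding w_def by (simp_all add: field_simps power2_eq_square)
      qed
      have Y: "Y = w / 2" using foc(4) w(1) nn(3,7) unfolding Ff by (auto simp: field_simps power2_eq_square)
      have "X * f z = 1 - (1 - F z)" using foc(3) by simp
      then have X: "X * w = u * D - w\<^sup>2 / 2" using nn(3,7) unfolding Ff by (simp add: field_simps)
      have "X = w / 2 + b - u + w" using z Y by (simp add: w_def)
      then have X': "X = (3 * w - 2 * a) / 2" using nn(6) by simp
      have uD: "u * D = w * (2 * w - a)"
        using X unfolding X' by (simp add: field_simps power2_eq_square)
      \<comment> \<open>Through u D = w (2 w - a), the regime bound w < D becomes w > a + b / 2, and
        w < u becomes D < a + 2 b.\<close>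
      have "w * u < u * D" using w nn(7) by (simp add: mult.commute)
      then have ge: "u < 2 * w - a" using w unfolding uD by simp
      have "w * (2 * w - a) < u * (2 * u - a)"
        using w ge nn by (intro mult_strict_mono) auto
      then have "u * D < u * (a + 2 * b)" using uD nn by (simp add: algebra_simps)
      then have lt: "D < a + 2 * b" using nn by simp
      have r: "X * F z = (3 * w - 2 * a)\<^sup>2 / (4 * (2 * w - a))"
      proof -
        have "F z = 1 - w\<^sup>2 / (2 * (w * (2 * w - a)))" using Ff(1) uD by (simp add: mult.assoc)
        also have "\<dots> = (3 * w - 2 * a) / (2 * (2 * w - a))"
          using w ge nn by (simp add: field_simps power2_eq_square)
        finally show ?thesis unfolding X' by (simp add: power2_eq_square)
      qed
      have s: "Y * (1 - F z) = w\<^sup>2 / (4 * (2 * w - a))"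
        using w ge nn unfolding Ff(1) Y mult.assoc uD by (simp add: field_simps power2_eq_square)
      have "\<not> D \<le> a + b / 2" using w ge nn by simp
      moreover have "\<not> (0 \<le> z \<and> z + D \<le> u)" using 4 by simp
      moreover have "revenues a b D (X * F z) (Y * (1 - F z))"
        unfolding revenues_def r s using \<open>\<not> D \<le> a + b / 2\<close> lt w ge nn uD
        by (auto intro!: exI[of _ w] simp: mult.commute)
      ultimately show ?thesis by blast
    qed
  qed
  then show "revenues a b D (X * F z) (Y * (1 - F z))" "0 \<le> z \<and> z + D \<le> u \<longleftrightarrow> D \<le> a + b / 2"
    by blast+
qed

lemma revenues_degenerate:
  assumes "0 \<le> X" "0 \<le> Y"
    and bestX: "\<And>p. 0 \<le> p \<Longrightarrow> p * share 0 0 (Y - p) \<le> X * share 0 0 (Y - X)"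
    and bestY: "\<And>p. 0 \<le> p \<Longrightarrow> p * (1 - share 0 0 (p - X)) \<le> Y * (1 - share 0 0 (Y - X))"
  shows "X = 0" "Y = 0"
proof -
  have F: "share 0 0 z = (if z < 0 then 0 else if z = 0 then 1 / 2 else 1)" for z
    by (simp add: share_misfit_zero)
  have "X \<le> Y" using bestY[of "(X + Y) / 2"] assms(1,2) by (auto simp: F field_simps split: if_splits)
  moreover have "Y \<le> X" using bestX[of "(X + Y) / 2"] assms(1,2) by (auto simp: F field_simps split: if_splits)
  ultimately have "X = Y" by simp
  \<comment> \<open>Bertrand undercutting: equal prices give half of the market, a lower price all
    of it, so any fraction of the price between 1/2 and 1 would serve.\<close>
  then have "X = 0" using bestX[of "3 * X / 4"] assms(1) by (auto simp: F field_simps split: if_splits)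
  with \<open>X = Y\<close> show "X = 0" "Y = 0" by auto
qed

lemma price_equilibrium:
  assumes nn: "0 \<le> a" "0 \<le> b" "0 \<le> D" "0 \<le> X" "0 \<le> Y"
    and bestX: "\<And>p. 0 \<le> p \<Longrightarrow> p * share (a + b) D (Y - p + b) \<le> X * share (a + b) D (Y - X + b)"
    and bestY: "\<And>p. 0 \<le> p \<Longrightarrow>
      p * (1 - share (a + b) D (p - X + b)) \<le> Y * (1 - share (a + b) D (Y - X + b))"
    and z: "z = Y - X + b"
  shows "revenues a b D (X * share (a + b) D z) (Y * (1 - share (a + b) D z)) \<and>
    (0 < a + b \<longrightarrow> (0 \<le> z \<and> z + D \<le> a + b \<longleftrightarrow> D \<le> a + b / 2))"
proof -
  consider "a + b = 0" "D = 0" | "a + b = 0" "D > 0" | "a + b > 0" "D = 0" | "a + b > 0" "D > 0"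
    using nn by linarith
  then show ?thesis
  proof cases
    case 1
    then have "a = 0" "b = 0" using nn by auto
    have "X = 0" "Y = 0"
      using revenues_degenerate[of X Y, OF nn(4,5)] bestX bestY 1 \<open>a = 0\<close> \<open>b = 0\<close> by simp_all
    then show ?thesis using 1 by (simp add: revenues_def)
  next
    case 2
    show ?thesis
      using revenues_clip(1)[OF nn _ refl _ _ bestX bestY z] 2
      by (simp add: share_misfit_zero_gap_pos add.commute)
  next
    case 3
    show ?thesis
      using revenues_clip[OF nn _ refl _ _ bestX bestY z] 3 nn
      by (simp add: share_gap_zero)
  next
    case 4
    show ?thesis
      using revenues_interior[OF nn(1,2) _ nn(4,5) refl _ _ bestX bestY z] 4
      by (simp add: share_eq)
  qed
qed

section \<open>Quality stage\<close>

text \<open>A first-order condition from perturbations to one side only, as needed where a revenue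
  formula is valid on one side of the equilibrium gap. Payoff differences are exactly quadratic in
  the step \<open>h\<close>, so no derivatives are required.\<close>

lemma nonpos_if_small_perturbations:
  fixes A B e :: real
  assumes "0 < e" "\<And>h. 0 < h \<Longrightarrow> h < e \<Longrightarrow> h * A + h\<^sup>2 * B \<le> 0"
  shows "A \<le> 0"
proof (rule ccontr)
  assume "\<not> A \<le> 0"
  define h where "h = min (e / 2) (A / (2 * (\<bar>B\<bar> + 1)))"
  have h: "0 < h" "h < e" using assms(1) \<open>\<not> A \<le> 0\<close> by (auto simp: h_def)
  have "h * (\<bar>B\<bar> + 1) \<le> A / 2"
  proof -
    have "h \<le> A / (2 * (\<bar>B\<bar> + 1))" by (simp add: h_def)
    then show ?thesis by (simp add: field_simps)
  qed
  moreover have "h * (- B) < h * (\<bar>B\<bar> + 1)"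
    using h(1) by (intro mult_strict_left_mono) auto
  ultimately have "0 < A + h * B" using \<open>\<not> A \<le> 0\<close> by linarith
  then have "0 < h * (A + h * B)" using h(1) by simp
  with assms(2)[OF h] show False by (simp add: algebra_simps power2_eq_square)
qed

text \<open>With \<open>a = 0\<close> the middle regime simplifies to D A = 2 w^2 and s = w / 8,
  which makes the growth of the low revenue in the gap visible. The edge \<open>D = A / 2\<close> is
  absorbed with w = A / 2.\<close>

lemma revenues_no_misfit_high:
  assumes "revenues 0 A D r s" "0 \<le> A" "0 < D" "A / 2 \<le> D"
  shows "2 * A \<le> D \<Longrightarrow> r = (2 * D + A / 2)\<^sup>2 / (9 * D)"
    and "2 * A \<le> D \<Longrightarrow> s = (D - A / 2)\<^sup>2 / (9 * D)"
    and "D < 2 * A \<Longrightarrow> \<exists>w. A / 2 \<le> w \<and> w \<le> A \<and> D * A = 2 * w\<^sup>2 \<and> s = w / 8"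
proof -
  show "2 * A \<le> D \<Longrightarrow> r = (2 * D + A / 2)\<^sup>2 / (9 * D)" "2 * A \<le> D \<Longrightarrow> s = (D - A / 2)\<^sup>2 / (9 * D)"
    using assms by (auto simp: revenues_def split: if_splits)
  show "\<exists>w. A / 2 \<le> w \<and> w \<le> A \<and> D * A = 2 * w\<^sup>2 \<and> s = w / 8" if gap: "D < 2 * A"
  proof (cases "D \<le> A / 2")
    case True
    then have "A = 2 * D" using assms(4) by simp
    moreover from this have "s = A / 16"
      using assms by (simp add: revenues_def power2_eq_square)
    ultimately show ?thesis using assms(2) by (intro exI[of _ "A / 2"]) (simp add: power2_eq_square)
  next
    case False
    then obtain w where w: "A / 2 \<le> w" "w \<le> A" "D * A = w * (2 * w)" "s = w\<^sup>2 / (4 * (2 * w))"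
      using assms gap by (auto simp: revenues_def)
    then have "0 < w" using gap assms(2,3) by simp
    then have "s = w / 8" using w(4) by (simp add: power2_eq_square)
    then show ?thesis using w by (auto simp: power2_eq_square)
  qed
qed

text \<open>With \<open>b = 0\<close> the thresholds \<open>a + b / 2\<close> and
  \<open>a + 2 * b\<close> coincide, so the middle regime disappears, and the outer formulas agree
  at \<open>D = A\<close>.\<close>

lemma revenues_no_misfit_low:
  assumes "revenues A 0 D r s" "0 \<le> A" "0 < D" "A \<le> D"
  shows "r = (2 * D - A / 2)\<^sup>2 / (9 * D)" "s = (D + A / 2)\<^sup>2 / (9 * D)"
proof -
  have "r = (2 * D - A / 2)\<^sup>2 / (9 * D) \<and> s = (D + A / 2)\<^sup>2 / (9 * D)"
  proof (cases "D = A")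
    case True
    then show ?thesis using assms by (simp add: revenues_def power2_eq_square field_simps)
  next
    case False
    then show ?thesis using assms by (simp add: revenues_def add.commute)
  qed
  then show "r = (2 * D - A / 2)\<^sup>2 / (9 * D)" "s = (D + A / 2)\<^sup>2 / (9 * D)" by auto
qed

text \<open>(D + c)^2 / D = D + 2 c + c^2 / D increases once D is at least the absolute value of
  c.\<close>

lemma divide_shift_square_mono:
  fixes c D D' :: real
  assumes "\<bar>c\<bar> \<le> D" "0 < D" "D \<le> D'"
  shows "(D + c)\<^sup>2 / (9 * D) \<le> (D' + c)\<^sup>2 / (9 * D')"
proof -
  have "c\<^sup>2 \<le> D * D'"
  proof -
    have "\<bar>c\<bar> * \<bar>c\<bar> \<le> D * D'" using assms by (intro mult_mono) auto
    then show ?thesis by (simp add: power2_eq_square)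
  qed
  then have "0 \<le> (D' - D) * (D * D' - c\<^sup>2)" using assms by simp
  then have "(D + c)\<^sup>2 * D' \<le> (D' + c)\<^sup>2 * D" by (simp add: algebra_simps power2_eq_square)
  then show ?thesis using assms by (simp add: field_simps)
qed

lemma revenues_no_misfit_high_mono:
  assumes "revenues 0 A D r s" "revenues 0 A D' r' s'" "0 \<le> A" "0 < D" "A / 2 \<le> D" "D \<le> D'"
  shows "s \<le> s'"
proof -
  note low = revenues_no_misfit_high[OF assms(1,3,4,5)]
  note low' = revenues_no_misfit_high[OF assms(2,3)]
  have pos: "0 < D'" "A / 2 \<le> D'" using assms by auto
  show ?thesis
  proof (cases "2 * A \<le> D")
    case True
    then show ?thesis
      using low(2) low'(2)[OF pos] divide_shift_square_mono[of "- (A / 2)" D D'] assms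
      by simp
  next
    case False
    then obtain w where w: "A / 2 \<le> w" "w \<le> A" "D * A = 2 * w\<^sup>2" "s = w / 8"
      using low(3) by (metis not_le)
    have "0 < A" using False assms(4) by simp
    show ?thesis
    proof (cases "2 * A \<le> D'")
      case True
      \<comment> \<open>The common value of the two regimes at the gap \<open>2 * A\<close>, where w
        = A; it separates \<open>s\<close> from \<open>s'\<close>.\<close>
      have "A / 8 = (2 * A + - (A / 2))\<^sup>2 / (9 * (2 * A))"
        using \<open>0 < A\<close> by (simp add: power2_eq_square)
      also have "\<dots> \<le> (D' + - (A / 2))\<^sup>2 / (9 * D')"
        by (rule divide_shift_square_mono) (use True \<open>0 < A\<close> in auto)
      finally show ?thesis using low'(2)[OF pos True] w by simp
    next
      case False
      then obtain w' where w': "A / 2 \<le> w'" "D' * A = 2 * w'\<^sup>2" "s' = w' / 8"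
        using low'(3)[OF pos] by (metis not_le)
      have "D * A \<le> D' * A" using assms \<open>0 < A\<close> by simp
      then have "w\<^sup>2 \<le> w'\<^sup>2" using w w' by simp
      then have "w \<le> w'" by (rule power2_le_imp_le) (use w' \<open>0 < A\<close> in simp)
      then show ?thesis using w w' by simp
    qed
  qed
qed

text \<open>Excludes the one non-local deviation from the symmetric equilibrium: from quality
  \<open>3 / 2\<close> a firm raises its quality by \<open>D\<close>, so far that the market is no
  longer explanation-dominated.\<close>

lemma revenues_symmetric_le:
  assumes "revenues v v D r s" "1 < v" "3 / 2 * v < D"
  shows "r - (3 / 2 + D)\<^sup>2 / 18 \<le> v / 2 - 1 / 8"
proof (cases "3 * v \<le> D")
  case True
  then have "r = (2 * D)\<^sup>2 / (9 * D)" using assms by (simp add: revenues_def)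
  then have r: "r = 4 * D / 9" using assms by (simp add: power2_eq_square)
  \<comment> \<open>\<open>5 / 2\<close> maximises 4 D / 9 - (3/2 + D)^2 / 18.\<close>
  have "0 \<le> (D - 5 / 2)\<^sup>2" by simp
  then show ?thesis using assms(2) unfolding r by (simp add: power2_eq_square field_simps)
next
  case False
  then obtain w where w: "3 / 2 * v \<le> w" "w \<le> 2 * v" "D * (2 * v) = w * (2 * w - v)"
    "r = (3 * w - 2 * v)\<^sup>2 / (4 * (2 * w - v))"
    using assms by (auto simp: revenues_def)
  \<comment> \<open>Dividing by \<open>v\<close> leaves a one-variable problem on [3/2, 2], with
    \<open>m\<close> = D / v ranging over [3/2, 3].\<close>
  define y where "y = w / v"
  have y: "3 / 2 \<le> y" "y \<le> 2" "w = v * y" using w(1,2) assms(2) by (auto simp: y_def field_simps)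
  have "v * (2 * D) = v * (v * (y * (2 * y - 1)))"
    using w(3) unfolding y(3) by (simp add: algebra_simps)
  then have D: "D = v * (y * (2 * y - 1) / 2)" using assms(2) by simp
  have r: "r = v * ((3 * y - 2)\<^sup>2 / (4 * (2 * y - 1)))"
  proof -
    have "3 * w - 2 * v = v * (3 * y - 2)" "2 * w - v = v * (2 * y - 1)"
      unfolding y(3) by (auto simp: algebra_simps)
    then show ?thesis unfolding w(4) using assms(2) y(1) by (simp add: power2_eq_square)
  qed
  define m where "m = y * (2 * y - 1) / 2"
  have m: "3 / 2 \<le> m"
  proof -
    have "(3 / 2) * 2 \<le> y * (2 * y - 1)" using y by (intro mult_mono) auto
    then show ?thesis by (simp add: m_def)
  qed
  have key: "(3 * y - 2)\<^sup>2 / (4 * (2 * y - 1)) \<le> 1 / 2 + m / 6 + m\<^sup>2 / 18"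
  proof -
    \<comment> \<open>Tangents at the midpoints of the two ranges bound the quartic in
      \<open>y\<close> from below by a line, and a quadratic inequality remains.\<close>
    have "0 \<le> (m - 9 / 4)\<^sup>2" "0 \<le> (y - 7 / 4)\<^sup>2" by simp_all
    then have "9 / 2 * m - 81 / 16 \<le> m\<^sup>2" "3 * y - 49 / 16 \<le> m"
      by (auto simp: m_def power2_eq_square field_simps)
    then have "5 / 4 * y - 203 / 192 \<le> 1 / 2 + m / 6 + m\<^sup>2 / 18" by simp
    then have "4 * (2 * y - 1) * (5 / 4 * y - 203 / 192) \<le> 4 * (2 * y - 1) * (1 / 2 + m / 6 + m\<^sup>2 / 18)"
      using y by (intro mult_left_mono) auto
    moreover have "(3 * y - 2)\<^sup>2 \<le> 4 * (2 * y - 1) * (5 / 4 * y - 203 / 192)"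
    proof -
      have "3 / 2 * y \<le> y * y" using y by simp
      moreover have "(3 * y - 2)\<^sup>2 = 9 * (y * y) - 12 * y + 4"
        by (simp add: power2_eq_square algebra_simps)
      moreover have "4 * (2 * y - 1) * (5 / 4 * y - 203 / 192) = 10 * (y * y) - 323 / 24 * y + 203 / 48"
        by (simp add: field_simps)
      ultimately show ?thesis using y(1) by linarith
    qed
    ultimately have "(3 * y - 2)\<^sup>2 \<le> 4 * (2 * y - 1) * (1 / 2 + m / 6 + m\<^sup>2 / 18)" by linarith
    then show ?thesis using y by (simp add: field_simps)
  qed
  have "r \<le> v * (1 / 2 + m / 6 + m\<^sup>2 / 18)"
    unfolding r by (rule mult_left_mono[OF key]) (use assms(2) in simp)
  also have "\<dots> \<le> v / 2 + D / 6 + D\<^sup>2 / 18"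
  proof -
    have "v * m\<^sup>2 \<le> v\<^sup>2 * m\<^sup>2" using assms(2) by (intro mult_right_mono) (auto simp: power2_eq_square)
    then show ?thesis unfolding D m_def[symmetric] by (simp add: algebra_simps)
  qed
  finally show ?thesis by (simp add: power2_eq_square field_simps)
qed

text \<open>The interface to the price stage: revenues are known only through the relation
  \<open>revenues\<close>, oriented from the firm with at least the rival's quality.\<close>

locale quality_stage =
  fixes a :: profile and r :: "profile \<Rightarrow> profile"
  assumes misfit_nonneg: "0 \<le> a i"
    and revenues: "(\<And>j. 0 \<le> q j) \<Longrightarrow> q (rival i) \<le> q i \<Longrightarrow>
      revenues (a i) (a (rival i)) (q i - q (rival i)) (r q i) (r q (rival i))"
begin

text \<open>In the explanation-dominated regime revenue is x^2 / (9 u), and x moves by 1/2 per unit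
  of quality. With cost q^2 / 18 the first-order condition is then q = x / u.\<close>

definition payoff :: "profile \<Rightarrow> firm \<Rightarrow> real" where
  "payoff q i = r q i - (q i)\<^sup>2 / 18"

lemma payoff_le:
  assumes "nash {0..} payoff q" "0 \<le> x"
  shows "r (q(i := x)) i - x\<^sup>2 / 18 \<le> payoff q i"
  using assms by (fastforce simp: nash_def payoff_def)

text \<open>The formulas for the better and the worse firm are one function of the signed gap, so
  deviations may cross gap 0 without a case split.\<close>

lemma explanation_revenue:
  assumes "\<And>j. 0 \<le> q j" "0 < a i + a (rival i)"
    and "- (a (rival i) + a i / 2) \<le> q i - q (rival i)" "q i - q (rival i) \<le> a i + a (rival i) / 2"
  shows "r q i = ((q i - q (rival i)) / 2 + a i + 2 * a (rival i))\<^sup>2 / (9 * (a i + a (rival i)))"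
proof (cases "q (rival i) \<le> q i")
  case True
  from revenues[of q i, OF assms(1) this] assms(2-4) show ?thesis
    by (simp add: revenues_def)
next
  case False
  then have "revenues (a (rival i)) (a i) (q (rival i) - q i) (r q (rival i)) (r q i)"
    using revenues[of q "rival i", OF assms(1)] by simp
  with assms(2-4) have "r q i = (2 * a (rival i) + a i - (q (rival i) - q i) / 2)\<^sup>2 / (9 * (a (rival i) + a i))"
    by (simp add: revenues_def add.commute)
  moreover have "2 * a (rival i) + a i - (q (rival i) - q i) / 2 = (q i - q (rival i)) / 2 + a i + 2 * a (rival i)"
    by (simp add: field_simps)
  ultimately show ?thesis by (simp only: add.commute[of "a (rival i)" "a i"])
qed

text \<open>A small increase of quality stays in the regime because the gap is strictly below the
  upper end; the lower end may be attained. The mirrored condition for decreases is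
  \<open>foc_down\<close>.\<close>

lemma foc_up:
  assumes "nash {0..} payoff q" "0 < a i + a (rival i)"
    and "- (a (rival i) + a i / 2) \<le> q i - q (rival i)" "q i - q (rival i) < a i + a (rival i) / 2"
  shows "((q i - q (rival i)) / 2 + a i + 2 * a (rival i)) / (a i + a (rival i)) \<le> q i"
proof -
  define u x where "u = a i + a (rival i)" and "x = (q i - q (rival i)) / 2 + a i + 2 * a (rival i)"
  have nn: "0 \<le> q j" for j using assms(1) by (auto simp: nash_def)
  have u: "0 < u" using assms(2) by (simp add: u_def)
  have "x / (9 * u) - q i / 9 \<le> 0"
  proof (rule nonpos_if_small_perturbations)
    show "0 < a i + a (rival i) / 2 - (q i - q (rival i))" using assms(4) by simp
    fix h assume h: "0 < h" "h < a i + a (rival i) / 2 - (q i - q (rival i))"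
    have "r (q(i := q i + h)) i = (x + h / 2)\<^sup>2 / (9 * u)"
      using explanation_revenue[of "q(i := q i + h)" i] nn assms h
      by (simp add: u_def x_def algebra_simps add_divide_distrib diff_divide_distrib)
    moreover have "r q i = x\<^sup>2 / (9 * u)"
      using explanation_revenue[of q i] nn assms by (simp add: u_def x_def)
    moreover have "r (q(i := q i + h)) i - (q i + h)\<^sup>2 / 18 \<le> payoff q i"
      by (rule payoff_le) (use assms(1) nn h in auto)
    ultimately have "(x + h / 2)\<^sup>2 / (9 * u) - (q i + h)\<^sup>2 / 18 \<le> x\<^sup>2 / (9 * u) - (q i)\<^sup>2 / 18"
      by (simp add: payoff_def)
    moreover have "(x + h / 2)\<^sup>2 / (9 * u) - (q i + h)\<^sup>2 / 18 - (x\<^sup>2 / (9 * u) - (q i)\<^sup>2 / 18) =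
       h * (x / (9 * u) - q i / 9) + h\<^sup>2 * (1 / (36 * u) - 1 / 18)"
      using u by (simp add: field_simps power2_eq_square)
    ultimately show "h * (x / (9 * u) - q i / 9) + h\<^sup>2 * (1 / (36 * u) - 1 / 18) \<le> 0" by linarith
  qed
  then have "x / u \<le> q i" using u by (simp add: field_simps)
  then show ?thesis by (simp add: x_def u_def)
qed

lemma foc_down:
  assumes "nash {0..} payoff q" "0 < a i + a (rival i)"
    and "- (a (rival i) + a i / 2) < q i - q (rival i)" "q i - q (rival i) \<le> a i + a (rival i) / 2"
  shows "q i \<le> ((q i - q (rival i)) / 2 + a i + 2 * a (rival i)) / (a i + a (rival i))"
\<comment> \<open>At quality 0 no decrease is possible, but the bound is nonnegative.\<close>
proof (cases "q i = 0")
  case True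
  then show ?thesis using assms(2-4) misfit_nonneg[of i] misfit_nonneg[of "rival i"]
    by (simp add: field_simps)
next
  case False
  define u x where "u = a i + a (rival i)" and "x = (q i - q (rival i)) / 2 + a i + 2 * a (rival i)"
  have nn: "0 \<le> q j" for j using assms(1) by (auto simp: nash_def)
  have u: "0 < u" using assms(2) by (simp add: u_def)
  have "q i / 9 - x / (9 * u) \<le> 0"
  proof (rule nonpos_if_small_perturbations)
    show "0 < min (q i) (q i - q (rival i) + (a (rival i) + a i / 2))"
      using assms(3) False nn[of i] by simp
    fix h assume h: "0 < h" "h < min (q i) (q i - q (rival i) + (a (rival i) + a i / 2))"
    have "r (q(i := q i - h)) i = (x - h / 2)\<^sup>2 / (9 * u)"
      using explanation_revenue[of "q(i := q i - h)" i] nn assms h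
      by (simp add: u_def x_def algebra_simps add_divide_distrib diff_divide_distrib)
    moreover have "r q i = x\<^sup>2 / (9 * u)"
      using explanation_revenue[of q i] nn assms by (simp add: u_def x_def)
    moreover have "r (q(i := q i - h)) i - (q i - h)\<^sup>2 / 18 \<le> payoff q i"
      by (rule payoff_le) (use assms(1) nn h in auto)
    ultimately have "(x - h / 2)\<^sup>2 / (9 * u) - (q i - h)\<^sup>2 / 18 \<le> x\<^sup>2 / (9 * u) - (q i)\<^sup>2 / 18"
      by (simp add: payoff_def)
    moreover have "(x - h / 2)\<^sup>2 / (9 * u) - (q i - h)\<^sup>2 / 18 - (x\<^sup>2 / (9 * u) - (q i)\<^sup>2 / 18) =
       h * (q i / 9 - x / (9 * u)) + h\<^sup>2 * (1 / (36 * u) - 1 / 18)"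
      using u by (simp add: field_simps power2_eq_square)
    ultimately show "h * (q i / 9 - x / (9 * u)) + h\<^sup>2 * (1 / (36 * u) - 1 / 18) \<le> 0" by linarith
  qed
  then have "q i \<le> x / u" using u by (simp add: field_simps)
  then show ?thesis by (simp add: x_def u_def)
qed

text \<open>At gap 0 the first-order condition is q = 3 v / (2 v) = 3/2. Within the regime payoffs
  are concave in the deviation. A decrease cannot leave it, since quality falls by at most 3/2 < 3 v
  / 2; larger increases are covered by \<open>revenues_symmetric_le\<close>.\<close>

lemma symmetric_equilibrium:
  assumes a: "\<And>i. a i = v" and "1 < v"
  shows "nash {0..} payoff (\<lambda>_. 3 / 2)"
  unfolding nash_def
proof (intro conjI allI ballI)
  fix i :: firm and x :: real
  assume x: "x \<in> {0..}"
  let ?q = "(\<lambda>_. 3 / 2)(i := x)"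
  have nn: "0 \<le> ?q j" for j using x by simp
  have "payoff (\<lambda>_. 3 / 2) i = v / 2 - 1 / 8"
    using explanation_revenue[of "\<lambda>_. 3 / 2" i] \<open>1 < v\<close>
    by (simp add: payoff_def a power2_eq_square)
  moreover have "payoff ?q i \<le> v / 2 - 1 / 8"
  proof (cases "x - 3 / 2 \<le> 3 / 2 * v")
    case True
    define g where "g = x - 3 / 2"
    have "r ?q i = ((x - 3 / 2) / 2 + 3 * v)\<^sup>2 / (18 * v)"
      using explanation_revenue[of ?q i, OF nn] True x \<open>1 < v\<close> by (simp add: a add.commute)
    then have "payoff ?q i = (g / 2 + 3 * v)\<^sup>2 / (18 * v) - (g + 3 / 2)\<^sup>2 / 18"
      by (simp add: payoff_def g_def)
    also have "\<dots> = v / 2 - 1 / 8 + g\<^sup>2 * (1 / (72 * v) - 1 / 18)"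
      using \<open>1 < v\<close> by (simp add: field_simps power2_eq_square)
    also have "\<dots> \<le> v / 2 - 1 / 8"
    proof -
      have "1 / (72 * v) \<le> 1 / 18" using \<open>1 < v\<close> by (simp add: field_simps)
      then have "g\<^sup>2 * (1 / (72 * v) - 1 / 18) \<le> 0" by (intro mult_nonneg_nonpos) auto
      then show ?thesis by simp
    qed
    finally show ?thesis .
  next
    case False
    then have "revenues v v (x - 3 / 2) (r ?q i) (r ?q (rival i))"
      using revenues[of ?q i, OF nn] \<open>1 < v\<close> by (simp add: a)
    from revenues_symmetric_le[OF this \<open>1 < v\<close>] False show ?thesis
      by (simp add: payoff_def)
  qed
  ultimately show "payoff ?q i \<le> payoff (\<lambda>_. 3 / 2) i" by simp
qed simp

text \<open>The condition of the better firm against decreases and that of the worse firm against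
  increases give g \<le> g / (2 v) for the gap g, even at the edge of the regime. Hence g =
  0.\<close>

lemma symmetric_payoff:
  assumes a: "\<And>i. a i = v" and "1 < v" and q: "nash {0..} payoff q"
    and i: "q (rival i) \<le> q i" "q i - q (rival i) \<le> 3 / 2 * v"
  shows "payoff q j = v / 2 - 1 / 8"
proof -
  have nn: "0 \<le> q j" for j using q by (auto simp: nash_def)
  have "q i \<le> ((q i - q (rival i)) / 2 + 3 * v) / (2 * v)"
    using foc_down[OF q, of i] i \<open>1 < v\<close> by (simp add: a add.commute)
  moreover have "((q (rival i) - q i) / 2 + 3 * v) / (2 * v) \<le> q (rival i)"
    using foc_up[OF q, of "rival i"] i \<open>1 < v\<close> by (simp add: a add.commute)
  ultimately have "q i - q (rival i) \<le> (q i - q (rival i)) / (2 * v)"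
    using \<open>1 < v\<close> by (simp add: field_simps)
  then have "(q i - q (rival i)) * (2 * v - 1) \<le> 0"
    using \<open>1 < v\<close> by (simp add: field_simps)
  then have eq: "q (rival i) = q i" using i(1) \<open>1 < v\<close> by (simp add: mult_le_0_iff)
  then have eq: "q (rival j) = q j" by (cases i; cases j; simp)
  have "3 / 2 \<le> q j" "q j \<le> 3 / 2"
    using foc_up[OF q, of j] foc_down[OF q, of j] eq \<open>1 < v\<close> by (auto simp: a)
  then have "q j = 3 / 2" by simp
  moreover have "r q j = v / 2"
    using explanation_revenue[of q j, OF nn] eq \<open>1 < v\<close> by (simp add: a power2_eq_square)
  ultimately show ?thesis by (simp only: payoff_def) (simp add: power2_eq_square)
qed

text \<open>
  Once one misfit cost vanishes, no equilibrium lies in the interior of the explanation-dominated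
  regime, and outside of it the revenue of the low-quality firm grows with the quality gap. That
  firm therefore chooses quality \<open>0\<close>, and comparing the choice of the other one with quality \<open>4\<close>
  gives the bound.
\<close>

lemma full_explanation_payoff:
  assumes "a i \<le> 2" and j: "a (rival i) = 0" and q: "nash {0..} payoff q"
  shows "3 / 8 < payoff q (rival i)"
proof -
  define A j where "A = a i" and "j = rival i"
  have A: "0 \<le> A" "A \<le> 2" using assms(1) misfit_nonneg[of i] by (auto simp: A_def)
  have [simp]: "a i = A" "a j = 0" "rival i = j" "rival j = i" "i \<noteq> j" "j \<noteq> i"
    using assms by (auto simp: A_def j_def)
  have nn: "0 \<le> q k" for k using q by (auto simp: nash_def)
  consider "A = 0" "q i = q j" | "A / 2 \<le> q j - q i" "q i < q j" | "A \<le> q i - q j" "q j < q i"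
    | "0 < A" "- (A / 2) < q i - q j" "q i - q j < A"
    using A by linarith
  then show ?thesis
  proof cases
    case 1
    have "r q i = 0" using revenues[of q i, OF nn] 1 by (simp add: revenues_def)
    \<comment> \<open>With equal qualities and no misfit both revenues vanish. Raising quality by 2
      earns revenue 8/9 at extra cost (4 q + 4) / 18, which is unprofitable only if q \<ge> 3; but
      then dropping to quality 0 pays.\<close>
    have "3 \<le> q i"
    proof -
      have "revenues A 0 2 (r (q(i := q i + 2)) i) (r (q(i := q i + 2)) j)"
        using revenues[of "q(i := q i + 2)" i] nn 1(2) by simp
      then have "r (q(i := q i + 2)) i = 8 / 9"
        using revenues_no_misfit_low(1) 1(1) by fastforce
      moreover have "r (q(i := q i + 2)) i - (q i + 2)\<^sup>2 / 18 \<le> payoff q i"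
        by (rule payoff_le[OF q]) (simp add: nn)
      ultimately show ?thesis
        using \<open>r q i = 0\<close> by (simp add: payoff_def power2_eq_square field_simps)
    qed
    have "revenues 0 A (q i) (r (q(i := 0)) j) (r (q(i := 0)) i)"
      using revenues[of "q(i := 0)" j] nn 1(2) by simp
    then have "r (q(i := 0)) i = (q i)\<^sup>2 / (9 * q i)"
      using revenues_no_misfit_high(2) 1(1) \<open>3 \<le> q i\<close> by fastforce
    moreover have "r (q(i := 0)) i \<le> payoff q i" using payoff_le[OF q, of 0 i] by simp
    ultimately have "(q i)\<^sup>2 / (9 * q i) \<le> - ((q i)\<^sup>2 / 18)"
      using \<open>r q i = 0\<close> by (simp add: payoff_def)
    moreover have "0 < (q i)\<^sup>2 / (9 * q i)" "0 \<le> (q i)\<^sup>2 / 18" using \<open>3 \<le> q i\<close> by auto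
    ultimately have False by linarith
    then show ?thesis ..
  next
    case 2
    have R: "revenues 0 A (q j - q i) (r q j) (r q i)"
      using revenues[of q j, OF nn] 2 by simp
    have "revenues 0 A (q j) (r (q(i := 0)) j) (r (q(i := 0)) i)"
      using revenues[of "q(i := 0)" j] nn by simp
    then have "r q i \<le> r (q(i := 0)) i"
      by (rule revenues_no_misfit_high_mono[OF R]) (use A 2 nn in auto)
    moreover have "r (q(i := 0)) i \<le> payoff q i" using payoff_le[OF q, of 0 i] by simp
    ultimately have "(q i)\<^sup>2 \<le> 0" unfolding payoff_def by linarith
    then have "q i = 0" by simp
    \<comment> \<open>\<open>4\<close> maximises 4 y / 9 - y^2 / 18, the payoff against a rival of
      quality 0 when \<open>A = 0\<close>.\<close>
    then have "revenues 0 A 4 (r (q(j := 4)) j) (r (q(j := 4)) i)"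
      using revenues[of "q(j := 4)" j] nn by simp
    from revenues_no_misfit_high(1)[OF this] have "r (q(j := 4)) j = (8 + A / 2)\<^sup>2 / 36"
      using A by simp
    also have "\<dots> \<ge> 8\<^sup>2 / 36" using A by (intro divide_right_mono power_mono) auto
    finally have "16 / 9 \<le> r (q(j := 4)) j" by simp
    moreover have "r (q(j := 4)) j - 4\<^sup>2 / 18 \<le> payoff q j" by (rule payoff_le[OF q]) simp
    ultimately show ?thesis by simp
  next
    case 3
    have "revenues A 0 (q i - q j) (r q i) (r q j)"
      using revenues[of q i, OF nn] 3 by simp
    note R = revenues_no_misfit_low[OF this]
    have "revenues A 0 (q i) (r (q(j := 0)) i) (r (q(j := 0)) j)"
      using revenues[of "q(j := 0)" i] nn by simp
    note R' = revenues_no_misfit_low[OF this]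
    have "r q j \<le> r (q(j := 0)) j"
      using R R' divide_shift_square_mono[of "A / 2" "q i - q j" "q i"] A 3 nn[of j] by simp
    moreover have "r (q(j := 0)) j \<le> payoff q j" using payoff_le[OF q, of 0 j] by simp
    ultimately have "(q j)\<^sup>2 \<le> 0" unfolding payoff_def by linarith
    then have "q j = 0" by simp
    define y where "y = q i"
    have y: "A \<le> y" "0 < y" using 3 \<open>q j = 0\<close> by (auto simp: y_def)
    have ri: "r q i = (2 * y - A / 2)\<^sup>2 / (9 * y)" and rj: "r q j = (y + A / 2)\<^sup>2 / (9 * y)"
      using R A 3 \<open>q j = 0\<close> by (auto simp: y_def)
    have "revenues A 0 4 (r (q(i := 4)) i) (r (q(i := 4)) j)"
      using revenues[of "q(i := 4)" i] nn \<open>q j = 0\<close> by simp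
    then have "r (q(i := 4)) i = (8 - A / 2)\<^sup>2 / 36"
      using revenues_no_misfit_low(1) A by fastforce
    moreover have "r (q(i := 4)) i - 4\<^sup>2 / 18 \<le> payoff q i" by (rule payoff_le[OF q]) simp
    ultimately have "(8 - A / 2)\<^sup>2 / 36 - 8 / 9 \<le> (2 * y - A / 2)\<^sup>2 / (9 * y) - y\<^sup>2 / 18"
      unfolding payoff_def ri by (simp add: y_def)
    \<comment> \<open>The payoff comparison factors because y = 4 gives equality. As A^2 \<le> 2 y,
      either y \<ge> 4 or 4 - y \<le> 1/4.\<close>
    then have "0 \<le> (4 - y) * (A\<^sup>2 - 8 * y * (4 - y))"
      using y by (simp add: field_simps power2_eq_square)
    moreover have "A\<^sup>2 \<le> 2 * y" using A y by (simp add: power2_eq_square mult_mono)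
    ultimately have "15 / 4 \<le> y"
    proof (intro leI notI)
      assume "y < 15 / 4" and le: "0 \<le> (4 - y) * (A\<^sup>2 - 8 * y * (4 - y))" "A\<^sup>2 \<le> 2 * y"
      then have "8 * y * (4 - y) \<le> y * 2" by (simp add: zero_le_mult_iff)
      then have "y * (8 * (4 - y)) \<le> y * 2" by (simp add: mult_ac)
      then have "8 * (4 - y) \<le> 2" using y(2) by (simp only: mult_le_cancel_left_pos)
      with \<open>y < 15 / 4\<close> show False by simp
    qed
    have "payoff q j = (y + A / 2)\<^sup>2 / (9 * y)" using \<open>q j = 0\<close> rj by (simp add: payoff_def)
    also have "\<dots> \<ge> y\<^sup>2 / (9 * y)" using A y by (intro divide_right_mono power_mono) auto
    finally have "y / 9 \<le> payoff q j" using y by (simp add: power2_eq_square)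
    then show ?thesis using \<open>15 / 4 \<le> y\<close> by simp
  next
    case 4
    have "q i = ((q i - q j) / 2 + A) / A"
      using foc_up[OF q, of i] foc_down[OF q, of i] 4 by simp
    moreover have "q j = ((q j - q i) / 2 + 2 * A) / A"
      using foc_up[OF q, of j] foc_down[OF q, of j] 4 by simp
    ultimately have "(q i - q j) * A = q i - q j - A"
      using 4 by (simp add: field_simps)
    define g where "g = q i - q j"
    have "g * A = g - A" using \<open>(q i - q j) * A = q i - q j - A\<close> by (simp add: g_def)
    \<comment> \<open>The only candidate is g = A / (1 - A). It is at least A for A < 1 and at most
      - A for 1 < A \<le> 2, in both cases outside the interior of the regime.\<close>
    then have g: "- A = g * (A - 1)" by (simp add: algebra_simps)
    have bounds: "- (A / 2) < g" "g < A" using 4 by (auto simp: g_def)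
    have False
    proof (cases "1 \<le> A")
      case True
      then have "- (A / 2) * (A - 1) \<le> g * (A - 1)" using bounds by (intro mult_right_mono) auto
      then have "- (A / 2) * (A - 1) \<le> - A" by (simp only: g[symmetric])
      then have "A * 2 \<le> A * (A - 1)" by (simp add: field_simps)
      then have "2 \<le> A - 1" using 4(1) by (simp only: mult_le_cancel_left_pos)
      then show False using A by simp
    next
      case False
      then have "A * (A - 1) \<le> g * (A - 1)" using bounds by (intro mult_right_mono_neg) auto
      then have "A * (A - 1) \<le> - A" by (simp only: g[symmetric])
      then have "A * A \<le> 0" by (simp add: algebra_simps)
      then show False using mult_pos_pos[OF 4(1) 4(1)] by linarith
    qed
    then show ?thesis ..
  qed
qed

text \<open>The dichotomy behind the two deviations at stage 0. The bound on \<open>a i\<close> in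
  the first alternative is what \<open>full_explanation_payoff\<close> asks for.\<close>

lemma asymmetric_payoff:
  assumes q: "nash {0..} payoff q" and a: "0 < a i + a (rival i)" "a i \<noteq> a (rival i)"
    and D: "q (rival i) \<le> q i" "q i - q (rival i) \<le> a i + a (rival i) / 2"
  shows "payoff q (rival i) \<le> 3 / 8 \<and> a i \<le> 2 \<or>
    1 < a (rival i) \<and> payoff q i < a (rival i) / 2 - 1 / 8"
proof -
  \<comment> \<open>One third of \<open>x\<^sub>1\<close> and of \<open>x\<^sub>2\<close> are the
    equilibrium prices, and these add up to \<open>u\<close>.\<close>
  define u b D x\<^sub>1 x\<^sub>2 where "u = a i + a (rival i)" and "b = a (rival i)"
    and "D = q i - q (rival i)" and "x\<^sub>1 = D / 2 + a i + 2 * b" and "x\<^sub>2 = 2 * a i + b - D / 2"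
  have nn: "0 \<le> q j" for j using q by (auto simp: nash_def)
  have u: "0 < u" "u = a i + b" and b: "0 \<le> a i" "0 \<le> b" "a i \<noteq> b"
    using a misfit_nonneg by (auto simp: u_def b_def)
  have D: "0 \<le> D" "D \<le> a i + b / 2" using D by (auto simp: D_def b_def)
  have x2: "0 \<le> x\<^sub>2" "x\<^sub>1 + x\<^sub>2 = 3 * u" using D b by (auto simp: x\<^sub>1_def x\<^sub>2_def u)
  have r1: "r q i = x\<^sub>1\<^sup>2 / (9 * u)" 
    using explanation_revenue[of q i, OF nn] a b D by (simp add: x\<^sub>1_def D_def b_def u_def)
  have r2: "r q (rival i) = x\<^sub>2\<^sup>2 / (9 * u)"
    using explanation_revenue[of q "rival i", OF nn] a b D
    by (simp add: x\<^sub>2_def D_def b_def u_def algebra_simps add_divide_distrib diff_divide_distrib)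
  have q1: "q i \<le> x\<^sub>1 / u"
    using foc_down[OF q, of i] a b D by (simp add: x\<^sub>1_def D_def b_def u_def)
  have q2: "x\<^sub>2 / u \<le> q (rival i)"
    using foc_up[OF q, of "rival i"] a b D
    by (simp add: x\<^sub>2_def D_def b_def u_def algebra_simps add_divide_distrib diff_divide_distrib)
  have diff: "D * u \<le> x\<^sub>1 - x\<^sub>2"
  proof -
    have "D \<le> (x\<^sub>1 - x\<^sub>2) / u" using q1 q2 by (simp add: D_def diff_divide_distrib)
    then show ?thesis using u(1) by (simp add: pos_le_divide_eq)
  qed
  have pay2: "payoff q (rival i) \<le> x\<^sub>2\<^sup>2 * (2 * u - 1) / (18 * u\<^sup>2)"
  proof -
    have "(x\<^sub>2 / u)\<^sup>2 \<le> (q (rival i))\<^sup>2" using q2 x2 u by (intro power_mono) auto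
    then have "payoff q (rival i) \<le> x\<^sub>2\<^sup>2 / (9 * u) - (x\<^sub>2 / u)\<^sup>2 / 18"
      unfolding payoff_def r2 by simp
    also have "\<dots> = x\<^sub>2\<^sup>2 * (2 * u - 1) / (18 * u\<^sup>2)"
      using u(1) by (simp add: field_simps power2_eq_square)
    finally show ?thesis .
  qed
  consider "u \<le> 2" | "2 < u" "D = a i + b / 2" | "2 < u" "D < a i + b / 2" using D by linarith
  then show ?thesis
  proof cases
    case 1
    have "0 \<le> D * u" using D u by simp
    then have "x\<^sub>2 \<le> 3 / 2 * u" using diff x2 by simp
    then have "x\<^sub>2\<^sup>2 \<le> (3 / 2 * u)\<^sup>2" using x2 by (intro power_mono) auto
    then have x: "x\<^sub>2\<^sup>2 / (18 * u\<^sup>2) \<le> 1 / 8" using u(1) by (simp add: field_simps power2_eq_square)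
    have "x\<^sub>2\<^sup>2 / (18 * u\<^sup>2) * (2 * u - 1) \<le> 1 / 8 * 3"
    proof (cases "0 \<le> 2 * u - 1")
      case True
      with x 1 show ?thesis by (intro mult_mono) auto
    next
      case False
      then have "x\<^sub>2\<^sup>2 / (18 * u\<^sup>2) * (2 * u - 1) \<le> 0" by (intro mult_nonneg_nonpos) auto
      then show ?thesis by simp
    qed
    then show ?thesis using pay2 1 u b by simp
  next
    case 2
    \<comment> \<open>At the edge of the regime the first-order conditions are one-sided, but the
      gap is known. It turns out to be at most 3/2, so even the revenue of the worse firm is at most
      9/32.\<close>
    have x2': "x\<^sub>2 = 3 / 2 * D" "x\<^sub>1 - x\<^sub>2 = 3 / 2 * b" using 2 by (auto simp: x\<^sub>2_def x\<^sub>1_def field_simps)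
    have Db: "D * u \<le> 3 / 2 * b" using diff x2' by simp
    have "b * u / 2 \<le> D * u" using 2 b u by (simp add: mult_right_mono)
    then have "b * (u - 3) \<le> 0" using Db by (simp add: algebra_simps)
    moreover have "b \<noteq> 0"
    proof
      assume "b = 0"
      then have "D * u \<le> 0" using Db by simp
      then show False using u 2 \<open>b = 0\<close> by (simp add: mult_le_0_iff)
    qed
    ultimately have "u \<le> 3" using b by (simp add: mult_le_0_iff)
    have "D * 2 \<le> D * u" using 2(1) D by (intro mult_left_mono) auto
    then have Db2: "D \<le> 3 / 4 * b" using Db by simp
    then have ai: "a i \<le> 2" using 2 \<open>u \<le> 3\<close> u b by auto
    have "payoff q (rival i) \<le> x\<^sub>2\<^sup>2 / (9 * u)" using r2 by (simp add: payoff_def)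
    also have "\<dots> \<le> x\<^sub>2\<^sup>2 / 18" using 2(1) by (intro divide_left_mono) auto
    also have "\<dots> = D\<^sup>2 / 8" unfolding x2' by (simp add: power2_eq_square)
    finally have "payoff q (rival i) \<le> D\<^sup>2 / 8" .
    moreover have "D \<le> 3 / 2"
    proof -
      have "D * u \<le> 3 / 2 * u" using Db b u by simp
      then show ?thesis using u(1) by (simp only: mult_le_cancel_right_pos)
    qed
    then have "D\<^sup>2 \<le> (3 / 2)\<^sup>2" using D by (intro power_mono) auto
    ultimately show ?thesis using ai by (simp add: power2_eq_square)
  next
    case 3
    have q1': "x\<^sub>1 / u \<le> q i"
      using foc_up[OF q, of i] a b D 3 by (simp add: x\<^sub>1_def D_def b_def u_def)
    have q2': "q (rival i) \<le> x\<^sub>2 / u"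
      using foc_down[OF q, of "rival i"] a b D 3
      by (simp add: x\<^sub>2_def D_def b_def u_def algebra_simps add_divide_distrib diff_divide_distrib)
    have qi: "q i = x\<^sub>1 / u" and qj: "q (rival i) = x\<^sub>2 / u" using q1 q2 q1' q2' by auto
    have Dx: "D * u = x\<^sub>1 - x\<^sub>2" using qi qj u by (simp add: D_def field_simps)
    have x: "x\<^sub>1 = u * (3 + D) / 2" "x\<^sub>2 = u * (3 - D) / 2" using Dx x2 by (auto simp: algebra_simps)
    have bD: "b - a i = D * (u - 1)" using Dx by (simp add: x\<^sub>1_def x\<^sub>2_def algebra_simps)
    then have "D \<noteq> 0" using b by auto
    then have "0 < D" using D by simp
    then have "0 < b - a i" unfolding bD using 3 by simp
    have b2: "b = (u + D * (u - 1)) / 2" using bD u by simp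
    have "0 \<le> 3 - D" using x2(1) x(2) u by (simp add: zero_le_mult_iff)
    have pay1: "payoff q i = (3 + D)\<^sup>2 * (2 * u - 1) / 72"
      unfolding payoff_def r1 qi x using u(1) by (simp add: field_simps power2_eq_square)
    have pay2': "payoff q (rival i) = (3 - D)\<^sup>2 * (2 * u - 1) / 72"
      unfolding payoff_def r2 qj x using u(1) by (simp add: field_simps power2_eq_square)
    show ?thesis
    \<comment> \<open>Divided by \<open>D\<close>, this is exactly the statement that the better
      firm earns less than b / 2 - 1/8.\<close>
    proof (cases "D * (2 * u - 1) < 6 * (u - 2)")
      case True
      then have "D * (D * (2 * u - 1)) < D * (6 * (u - 2))" using \<open>0 < D\<close> by simp
      then have "(3 + D)\<^sup>2 * (2 * u - 1) < 9 * (2 * u - 1) + 18 * (D * (u - 1))"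
        by (simp add: algebra_simps power2_eq_square)
      then have "payoff q i < b / 2 - 1 / 8"
        unfolding pay1 b2 by (simp add: field_simps)
      then show ?thesis using \<open>0 < b - a i\<close> 3 u by (simp add: b_def)
    next
      case False
      then have *: "(3 - D) * (2 * u - 1) \<le> 9" by (simp add: algebra_simps)
      have "(3 - D) * ((3 - D) * (2 * u - 1)) \<le> 3 * 9"
        using * \<open>0 \<le> 3 - D\<close> \<open>0 < D\<close> 3 by (intro mult_mono) auto
      then have pay: "payoff q (rival i) \<le> 3 / 8" unfolding pay2' by (simp add: power2_eq_square algebra_simps)
      have "D \<le> u - (u + D * (u - 1)) / 4" using D(2) b2 u(2) by linarith
      then have "D * (u + 3) \<le> 3 * u" by (simp add: field_simps)
      then have *: "(D * (u + 3)) * (2 * u - 1) \<le> (3 * u) * (2 * u - 1)"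
        using 3 by (intro mult_right_mono) auto
      \<comment> \<open>The failed inequality bounds \<open>D\<close> from below, the regime bounds
        it by 3 u / (u + 3). Both together give u \<le> 4, and \<open>a i\<close> is the smaller
        summand of \<open>u\<close>.\<close>
      have "6 * (u * u) + 6 * u - 36 = (6 * (u - 2)) * (u + 3)" by (simp add: algebra_simps)
      also have "\<dots> \<le> (D * (2 * u - 1)) * (u + 3)"
        using False 3 by (intro mult_right_mono) auto
      also have "\<dots> = (D * (u + 3)) * (2 * u - 1)" by simp
      also note *
      also have "(3 * u) * (2 * u - 1) = 6 * (u * u) - 3 * u" by (simp add: algebra_simps)
      finally have "u \<le> 4" by simp
      then have "a i \<le> 2" using \<open>0 < b - a i\<close> u by simp
      then show ?thesis using pay by simp
    qed
  qed
qed

end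

section \<open>XAI stage\<close>

text \<open>Homogeneity of degree one: every price equilibrium scales with the unit of money, and so
  does the parameter \<open>w\<close>.\<close>

lemma revenues_scale:
  assumes "revenues a b D r s" "0 < k"
  shows "revenues (k * a) (k * b) (k * D) (k * r) (k * s)"
proof -
  have sq: "k * (x\<^sup>2 / (n * y)) = (k * x)\<^sup>2 / (n * (k * y))" for n x y :: real
    using assms(2) by (simp add: power2_eq_square)
  have lin: "k * a + k * b = k * (a + b)" "k * a + k * b / 2 = k * (a + b / 2)"
    "k * a + 2 * (k * b) = k * (a + 2 * b)" "k * D / 2 + k * a + 2 * (k * b) = k * (D / 2 + a + 2 * b)"
    "2 * (k * a) + k * b - k * D / 2 = k * (2 * a + b - D / 2)"
    "2 * (k * D) + (k * b - k * a) / 2 = k * (2 * D + (b - a) / 2)"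
    "k * D - (k * b - k * a) / 2 = k * (D - (b - a) / 2)"
    by (simp_all add: algebra_simps add_divide_distrib diff_divide_distrib)
  have ord: "k * x \<le> k * y \<longleftrightarrow> x \<le> y" "0 < k * x \<longleftrightarrow> 0 < x" "k * x = 0 \<longleftrightarrow> x = 0" for x y :: real
    using assms(2) by (simp_all add: zero_less_mult_iff)
  have mid: "\<exists>w'. k * (a + b / 2) \<le> w' \<and> w' \<le> k * (a + b) \<and>
      k * D * (k * (a + b)) = w' * (2 * w' - k * a) \<and>
      k * r = (3 * w' - 2 * (k * a))\<^sup>2 / (4 * (2 * w' - k * a)) \<and> k * s = w'\<^sup>2 / (4 * (2 * w' - k * a))"
    if "\<exists>w. a + b / 2 \<le> w \<and> w \<le> a + b \<and> D * (a + b) = w * (2 * w - a) \<and>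
      r = (3 * w - 2 * a)\<^sup>2 / (4 * (2 * w - a)) \<and> s = w\<^sup>2 / (4 * (2 * w - a))"
  proof -
    from that obtain w where w: "a + b / 2 \<le> w" "w \<le> a + b" "D * (a + b) = w * (2 * w - a)"
      "r = (3 * w - 2 * a)\<^sup>2 / (4 * (2 * w - a))" "s = w\<^sup>2 / (4 * (2 * w - a))" by blast
    have *: "2 * (k * w) - k * a = k * (2 * w - a)" "3 * (k * w) - 2 * (k * a) = k * (3 * w - 2 * a)"
      by (simp_all add: algebra_simps)
    have "k * D * (k * (a + b)) = k * k * (D * (a + b))" by simp
    also have "\<dots> = k * w * (k * (2 * w - a))" unfolding w(3) by simp
    finally have "k * D * (k * (a + b)) = k * w * (k * (2 * w - a))" .
    then show ?thesis
      by (intro exI[of _ "k * w"]) (use w(1,2) in \<open>simp only: * ord w(4,5) sq simp_thms\<close>)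
  qed
  show ?thesis
    using assms(1) mid unfolding revenues_def lin ord
    by (auto simp only: sq if_True if_False simp_thms split: if_splits)
qed

text \<open>The indifferent position is affine in \<theta>, so only \<theta> = 0 and \<theta> = 1
  need to be checked, and the sign of the quality gap tells which end is the smaller one.\<close>

lemma explanation_dominated_iff:
  assumes c: "\<And>i. c i = t * (1 - \<xi> i)" and u: "0 < c i + c (rival i)" and "q (rival i) \<le> q i"
  shows "explanation_dominated t \<xi> q p \<longleftrightarrow>
    0 \<le> p (rival i) - p i + c (rival i) \<and>
    p (rival i) - p i + c (rival i) + (q i - q (rival i)) \<le> c i + c (rival i)"
proof -
  define u D z where "u = c Firm1 + c Firm2" and "D = q Firm1 - q Firm2"
    and "z = p Firm2 - p Firm1 + c Firm2"
  have "0 < u" using u by (cases i) (auto simp: u_def)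
  have eq: "utility t \<xi> q p Firm1 (x, \<theta>) = utility t \<xi> q p Firm2 (x, \<theta>) \<longleftrightarrow> u * x = \<theta> * D + z"
    if "x \<in> {0..1}" for x \<theta>
    using that by (auto simp: utility_def u_def D_def z_def c algebra_simps)
  have ex: "(\<exists>x\<in>{0..1}. u * x = \<theta> * D + z) \<longleftrightarrow> 0 \<le> \<theta> * D + z \<and> \<theta> * D + z \<le> u" for \<theta>
  proof
    assume "0 \<le> \<theta> * D + z \<and> \<theta> * D + z \<le> u"
    then show "\<exists>x\<in>{0..1}. u * x = \<theta> * D + z"
      using \<open>0 < u\<close> by (intro bexI[of _ "(\<theta> * D + z) / u"]) auto
  next
    assume "\<exists>x\<in>{0..1}. u * x = \<theta> * D + z"
    then obtain x where "0 \<le> x" "x \<le> 1" "u * x = \<theta> * D + z" by auto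
    moreover have "0 \<le> u * x" "u * x \<le> u * 1"
      using \<open>0 < u\<close> \<open>0 \<le> x\<close> \<open>x \<le> 1\<close> by (auto intro: mult_left_mono)
    ultimately show "0 \<le> \<theta> * D + z \<and> \<theta> * D + z \<le> u" by simp
  qed
  have "(\<exists>x\<in>{0..1}. utility t \<xi> q p Firm1 (x, \<theta>) = utility t \<xi> q p Firm2 (x, \<theta>)) \<longleftrightarrow>
      0 \<le> \<theta> * D + z \<and> \<theta> * D + z \<le> u" for \<theta>
    unfolding ex[symmetric] using eq by (intro bex_cong) auto
  then have "explanation_dominated t \<xi> q p \<longleftrightarrow>
      (\<forall>\<theta>\<in>{0..1}. 0 \<le> \<theta> * D + z \<and> \<theta> * D + z \<le> u)"
    by (simp only: explanation_dominated_def)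
  also have "\<dots> \<longleftrightarrow> 0 \<le> z \<and> z \<le> u \<and> 0 \<le> D + z \<and> D + z \<le> u"
  proof
    assume "\<forall>\<theta>\<in>{0..1}. 0 \<le> \<theta> * D + z \<and> \<theta> * D + z \<le> u"
    from bspec[OF this, of 0] bspec[OF this, of 1]
    show "0 \<le> z \<and> z \<le> u \<and> 0 \<le> D + z \<and> D + z \<le> u" by simp
  next
    assume *: "0 \<le> z \<and> z \<le> u \<and> 0 \<le> D + z \<and> D + z \<le> u"
    show "\<forall>\<theta>\<in>{0..1}. 0 \<le> \<theta> * D + z \<and> \<theta> * D + z \<le> u"
    proof
      fix \<theta> :: real assume \<theta>: "\<theta> \<in> {0..1}"
      have "\<theta> * D + z = \<theta> * (D + z) + (1 - \<theta>) * z" by (simp add: algebra_simps)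
      moreover have "0 \<le> \<theta> * (D + z)" "0 \<le> (1 - \<theta>) * z" using * \<theta> by auto
      moreover have "\<theta> * (D + z) \<le> \<theta> * u" "(1 - \<theta>) * z \<le> (1 - \<theta>) * u"
        using * \<theta> by (auto intro: mult_left_mono)
      ultimately show "0 \<le> \<theta> * D + z \<and> \<theta> * D + z \<le> u" by (simp add: algebra_simps)
    qed
  qed
  also have "\<dots> \<longleftrightarrow> 0 \<le> p (rival i) - p i + c (rival i) \<and>
    p (rival i) - p i + c (rival i) + (q i - q (rival i)) \<le> c i + c (rival i)"
    using assms(3) by (cases i) (auto simp: u_def D_def z_def)
  finally show ?thesis .
qed

lemma price_stage:
  assumes "0 < t" and \<xi>: "\<And>i. \<xi> i \<in> {0..1}" and q: "q (rival i) \<le> q i"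
    and nash: "nash {0..} (profit \<beta> t \<xi> q) p"
  shows "revenues (t * (1 - \<xi> i)) (t * (1 - \<xi> (rival i))) (q i - q (rival i))
      (p i * demand t \<xi> q p i) (p (rival i) * demand t \<xi> q p (rival i))"
    and "0 < t * (1 - \<xi> i) + t * (1 - \<xi> (rival i)) \<Longrightarrow>
      explanation_dominated t \<xi> q p \<longleftrightarrow> q i - q (rival i) \<le> t * (1 - \<xi> i) + t * (1 - \<xi> (rival i)) / 2"
proof -
  define c where "c i = t * (1 - \<xi> i)" for i
  have c: "0 \<le> c i" for i using \<open>0 < t\<close> \<xi>[of i] by (simp add: c_def)
  have p: "0 \<le> p i" for i using nash by (auto simp: nash_def)
  have best: "x * demand t \<xi> q (p(i := x)) i \<le> p i * demand t \<xi> q p i" if "0 \<le> x" for x i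
    using nash that by (auto simp: nash_def profit_def)
  have share: "demand t \<xi> q p i = share (c i + c (rival i)) (q i - q (rival i)) (p (rival i) - p i + c (rival i))"
    for p by (rule demand_eq_share) (simp_all add: c_def[symmetric] c)
  have *: "revenues (c i) (c (rival i)) (q i - q (rival i))
      (p i * share (c i + c (rival i)) (q i - q (rival i)) (p (rival i) - p i + c (rival i)))
      (p (rival i) * (1 - share (c i + c (rival i)) (q i - q (rival i)) (p (rival i) - p i + c (rival i)))) \<and>
    (0 < c i + c (rival i) \<longrightarrow>
      (0 \<le> p (rival i) - p i + c (rival i) \<and>
        p (rival i) - p i + c (rival i) + (q i - q (rival i)) \<le> c i + c (rival i)
       \<longleftrightarrow> q i - q (rival i) \<le> c i + c (rival i) / 2))"
  proof (rule price_equilibrium[OF c c _ p p _ _ refl])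
    fix x :: real assume "0 \<le> x"
    show "x * share (c i + c (rival i)) (q i - q (rival i)) (p (rival i) - x + c (rival i))
      \<le> p i * share (c i + c (rival i)) (q i - q (rival i)) (p (rival i) - p i + c (rival i))"
      using best[OF \<open>0 \<le> x\<close>, of i] by (simp add: share)
    show "x * (1 - share (c i + c (rival i)) (q i - q (rival i)) (x - p i + c (rival i)))
      \<le> p (rival i) * (1 - share (c i + c (rival i)) (q i - q (rival i)) (p (rival i) - p i + c (rival i)))"
      using best[OF \<open>0 \<le> x\<close>, of "rival i"] by (simp add: share demand_rival)
  qed (use q in simp)
  then show "revenues (t * (1 - \<xi> i)) (t * (1 - \<xi> (rival i))) (q i - q (rival i))
      (p i * demand t \<xi> q p i) (p (rival i) * demand t \<xi> q p (rival i))"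
    by (simp add: demand_rival share flip: c_def)
  show "explanation_dominated t \<xi> q p \<longleftrightarrow> q i - q (rival i) \<le> t * (1 - \<xi> i) + t * (1 - \<xi> (rival i)) / 2"
    if "0 < t * (1 - \<xi> i) + t * (1 - \<xi> (rival i))"
    using * explanation_dominated_iff[OF c_def, where i = i and q = q and p = p] q that by (simp flip: c_def)
qed

text \<open>
  Measuring misfit costs, qualities and payoffs in units of \<open>1 / (18 * \<beta>)\<close> turns the quality
  cost into \<open>q\<^sup>2 / 18\<close> and removes \<open>\<beta>\<close> from the quality stage.
\<close>

definition scaled_misfit :: "real \<Rightarrow> real \<Rightarrow> profile \<Rightarrow> profile" where
  "scaled_misfit \<beta> t \<xi> i = 18 * \<beta> * (t * (1 - \<xi> i))"

definition scaled_revenue ::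
    "real \<Rightarrow> real \<Rightarrow> (profile \<Rightarrow> profile \<Rightarrow> profile) \<Rightarrow> profile \<Rightarrow> profile \<Rightarrow> profile" where
  "scaled_revenue \<beta> t P \<xi> q i = (let q' = (\<lambda>j. q j / (18 * \<beta>))
     in 18 * \<beta> * (P \<xi> q' i * demand t \<xi> q' (P \<xi> q') i))"

section \<open>Transfer between original and scaled units\<close>

context
  fixes \<beta> t :: real and P :: "profile \<Rightarrow> profile \<Rightarrow> profile" and \<xi> :: profile
  assumes pos: "0 < \<beta>" "0 < t" and P: "price_rule \<beta> t P" and \<xi>: "\<And>i. \<xi> i \<in> {0..1}"
begin

lemma nash_prices: "(\<And>i. 0 \<le> q i) \<Longrightarrow> nash {0..} (profit \<beta> t \<xi> q) (P \<xi> q)"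
  using P \<xi> by (simp add: price_rule_def)

lemma quality_stage: "quality_stage (scaled_misfit \<beta> t \<xi>) (scaled_revenue \<beta> t P \<xi>)"
proof
  show "0 \<le> scaled_misfit \<beta> t \<xi> i" for i
    using pos \<xi>[of i] by (simp add: scaled_misfit_def)
next
  fix q i assume q: "\<And>j. 0 \<le> (q j :: real)" "q (rival i) \<le> q i"
  define q' where "q' = (\<lambda>j. q j / (18 * \<beta>))"
  have q': "q i = 18 * \<beta> * q' i" for i using pos by (simp add: q'_def)
  have "revenues (t * (1 - \<xi> i)) (t * (1 - \<xi> (rival i))) (q' i - q' (rival i))
      (P \<xi> q' i * demand t \<xi> q' (P \<xi> q') i) (P \<xi> q' (rival i) * demand t \<xi> q' (P \<xi> q') (rival i))"
    by (rule price_stage(1)[OF pos(2) \<xi> _ nash_prices]) (use q pos in \<open>auto simp: q'_def divide_right_mono\<close>)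
  from revenues_scale[OF this, of "18 * \<beta>"] pos
  show "revenues (scaled_misfit \<beta> t \<xi> i) (scaled_misfit \<beta> t \<xi> (rival i)) (q i - q (rival i))
     (scaled_revenue \<beta> t P \<xi> q i) (scaled_revenue \<beta> t P \<xi> q (rival i))"
    by (simp add: scaled_misfit_def scaled_revenue_def Let_def q' right_diff_distrib flip: q'_def)
qed

interpretation quality_stage "scaled_misfit \<beta> t \<xi>" "scaled_revenue \<beta> t P \<xi>"
  by (rule quality_stage)

lemma scaled_payoff: "payoff (\<lambda>j. 18 * \<beta> * q j) i = 18 * \<beta> * profit \<beta> t \<xi> q (P \<xi> q) i"
  using pos by (simp add: payoff_def scaled_revenue_def profit_def Let_def power2_eq_square algebra_simps)

lemma quality_equilibrium_iff:
  "quality_equilibrium \<beta> t P \<xi> q \<longleftrightarrow> nash {0..} payoff (\<lambda>j. 18 * \<beta> * q j)"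
proof -
  let ?kq = "\<lambda>j. 18 * \<beta> * q j"
  have dev: "payoff (?kq(i := 18 * \<beta> * x)) i \<le> payoff ?kq i \<longleftrightarrow>
      profit \<beta> t \<xi> (q(i := x)) (P \<xi> (q(i := x))) i \<le> profit \<beta> t \<xi> q (P \<xi> q) i" for i x
  proof -
    have "?kq(i := 18 * \<beta> * x) = (\<lambda>j. 18 * \<beta> * (q(i := x)) j)" by auto
    then have "payoff (?kq(i := 18 * \<beta> * x)) i = 18 * \<beta> * profit \<beta> t \<xi> (q(i := x)) (P \<xi> (q(i := x))) i"
      using scaled_payoff[of "q(i := x)" i] by (simp only:)
    then show ?thesis using pos by (simp only: scaled_payoff[of q]) simp
  qed
  have "(\<forall>x\<in>{0..}. payoff (?kq(i := x)) i \<le> payoff ?kq i) \<longleftrightarrow>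
      (\<forall>x\<in>{0..}. profit \<beta> t \<xi> (q(i := x)) (P \<xi> (q(i := x))) i \<le> profit \<beta> t \<xi> q (P \<xi> q) i)" for i
  proof (intro iffI ballI)
    fix x :: real assume "x \<in> {0..}" "\<forall>x\<in>{0..}. payoff (?kq(i := x)) i \<le> payoff ?kq i"
    then show "profit \<beta> t \<xi> (q(i := x)) (P \<xi> (q(i := x))) i \<le> profit \<beta> t \<xi> q (P \<xi> q) i"
      unfolding dev[symmetric] using pos by (auto simp del: fun_upd_apply)
  next
    fix x :: real
    assume x: "x \<in> {0..}" and "\<forall>x\<in>{0..}. profit \<beta> t \<xi> (q(i := x)) (P \<xi> (q(i := x))) i \<le> profit \<beta> t \<xi> q (P \<xi> q) i"
    then have "payoff (?kq(i := 18 * \<beta> * (x / (18 * \<beta>)))) i \<le> payoff ?kq i"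
      unfolding dev using pos by (auto simp del: fun_upd_apply)
    then show "payoff (?kq(i := x)) i \<le> payoff ?kq i" using pos by (simp del: fun_upd_apply)
  qed
  moreover have "18 * \<beta> * q i \<in> {0..} \<longleftrightarrow> q i \<in> {0..}" for i
    using pos by (simp add: zero_le_mult_iff)
  ultimately show ?thesis by (simp only: quality_equilibrium_def nash_def)
qed

lemma explanation_dominated_gap:
  assumes "\<And>i. 0 \<le> q i" "q (rival i) \<le> q i" "0 < scaled_misfit \<beta> t \<xi> i + scaled_misfit \<beta> t \<xi> (rival i)"
  shows "explanation_dominated t \<xi> q (P \<xi> q) \<longleftrightarrow>
    18 * \<beta> * q i - 18 * \<beta> * q (rival i) \<le> scaled_misfit \<beta> t \<xi> i + scaled_misfit \<beta> t \<xi> (rival i) / 2"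
proof -
  define u where "u = t * (1 - \<xi> i) + t * (1 - \<xi> (rival i))"
  have "scaled_misfit \<beta> t \<xi> i + scaled_misfit \<beta> t \<xi> (rival i) = 18 * \<beta> * u"
    by (simp add: scaled_misfit_def u_def algebra_simps)
  then have "0 < u" using assms(3) pos by (simp add: zero_less_mult_iff)
  then have "explanation_dominated t \<xi> q (P \<xi> q) \<longleftrightarrow>
      q i - q (rival i) \<le> t * (1 - \<xi> i) + t * (1 - \<xi> (rival i)) / 2"
    unfolding u_def by (rule price_stage(2)[OF pos(2) \<xi> assms(2) nash_prices[OF assms(1)]])
  also have "\<dots> \<longleftrightarrow> 18 * \<beta> * (q i - q (rival i)) \<le> 18 * \<beta> * (t * (1 - \<xi> i) + t * (1 - \<xi> (rival i)) / 2)"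
    using pos by simp
  finally show ?thesis by (simp add: scaled_misfit_def algebra_simps)
qed

end

theorem proposition9:
  fixes \<beta> t :: real
  assumes "\<beta> > 0" and "t > 0"
  shows "\<not> (\<exists>\<xi> Q P.
      equilibrium \<beta> t \<xi> Q P \<and>
      explanation_dominated_selection \<beta> t Q P \<and>
      explanation_dominated t \<xi> (Q \<xi>) (P \<xi> (Q \<xi>)) \<and>
      Q \<xi> Firm1 \<ge> Q \<xi> Firm2 \<and>
      \<xi> Firm1 \<noteq> \<xi> Firm2)"
proof (intro notI, elim exE conjE)
  fix \<xi> Q P
  assume eq: "equilibrium \<beta> t \<xi> Q P" and sel: "explanation_dominated_selection \<beta> t Q P"
    and E: "explanation_dominated t \<xi> (Q \<xi>) (P \<xi> (Q \<xi>))"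
    and high: "Q \<xi> Firm1 \<ge> Q \<xi> Firm2" and neq: "\<xi> Firm1 \<noteq> \<xi> Firm2"
  have P: "price_rule \<beta> t P" and Q: "quality_rule \<beta> t P Q"
    and stage0: "nash {0..1} (\<lambda>\<xi>'. profit \<beta> t \<xi>' (Q \<xi>') (P \<xi>' (Q \<xi>'))) \<xi>"
    using eq by (auto simp: equilibrium_def)
  have \<xi>: "\<xi> i \<in> {0..1}" for i using stage0 by (auto simp: nash_def)
  \<comment> \<open>The continuation payoff, in scaled units, when the rules \<open>Q\<close> and
    \<open>P\<close> are followed after the XAI choices.\<close>
  define U where "U \<xi>' = quality_stage.payoff (scaled_revenue \<beta> t P \<xi>') (\<lambda>j. 18 * \<beta> * Q \<xi>' j)" for \<xi>'
  have U: "U \<xi>' i = 18 * \<beta> * profit \<beta> t \<xi>' (Q \<xi>') (P \<xi>' (Q \<xi>')) i"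
    if "\<And>j. \<xi>' j \<in> {0..1}" for \<xi>' i
    unfolding U_def by (rule scaled_payoff[where \<xi> = \<xi>', OF assms P that])
  have upd: "(\<xi>(i := x)) j \<in> {0..1}" if "x \<in> {0..1}" for i j x using \<xi> that by simp
  have no_gain: "U (\<xi>(i := x)) i \<le> U \<xi> i" if "x \<in> {0..1}" for i x
    unfolding U[where \<xi>' = "\<xi>(i := x)", OF upd[OF that]] U[where \<xi>' = \<xi>, OF \<xi>]
    by (rule mult_left_mono) (use stage0 that assms in \<open>auto simp: nash_def simp del: fun_upd_apply\<close>)
  have nashQ: "nash {0..} (quality_stage.payoff (scaled_revenue \<beta> t P \<xi>')) (\<lambda>j. 18 * \<beta> * Q \<xi>' j)"
    if "\<And>j. \<xi>' j \<in> {0..1}" for \<xi>'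
    unfolding quality_equilibrium_iff[where \<xi> = \<xi>', OF assms P that, symmetric]
    using Q that unfolding quality_rule_def by blast
  have Qnn: "0 \<le> Q \<xi>' i" if "\<And>j. \<xi>' j \<in> {0..1}" for \<xi>' i
    using Q that by (auto simp: quality_rule_def quality_equilibrium_def nash_def)
  define a where "a = scaled_misfit \<beta> t \<xi>"
  interpret quality_stage a "scaled_revenue \<beta> t P \<xi>"
    unfolding a_def by (rule quality_stage[where \<xi> = \<xi>, OF assms P \<xi>])
  have "a Firm1 \<noteq> a Firm2" using neq assms by (simp add: a_def scaled_misfit_def)
  then have upos: "0 < a Firm1 + a Firm2"
    using misfit_nonneg[of Firm1] misfit_nonneg[of Firm2] by linarith
  have gap: "18 * \<beta> * Q \<xi> Firm1 - 18 * \<beta> * Q \<xi> Firm2 \<le> a Firm1 + a Firm2 / 2"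
    using explanation_dominated_gap[where \<xi> = \<xi> and q = "Q \<xi>" and i = Firm1,
      OF assms P \<xi> Qnn[where \<xi>' = \<xi>, OF \<xi>]] E high upos by (simp add: a_def)
  have "U \<xi> Firm2 \<le> 3 / 8 \<and> a Firm1 \<le> 2 \<or> 1 < a Firm2 \<and> U \<xi> Firm1 < a Firm2 / 2 - 1 / 8"
    using asymmetric_payoff[where i = Firm1, OF nashQ[where \<xi>' = \<xi>, OF \<xi>]] upos \<open>a Firm1 \<noteq> a Firm2\<close> high gap assms
    by (simp add: U_def)
  then show False
  proof (elim disjE conjE)
    assume le: "U \<xi> Firm2 \<le> 3 / 8" and a1: "a Firm1 \<le> 2"
    define \<xi>' where "\<xi>' = \<xi>(Firm2 := 1)"
    have \<xi>': "\<xi>' j \<in> {0..1}" for j using \<xi> by (simp add: \<xi>'_def)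
    interpret full: quality_stage "scaled_misfit \<beta> t \<xi>'" "scaled_revenue \<beta> t P \<xi>'"
      by (rule quality_stage[where \<xi> = \<xi>', OF assms P \<xi>'])
    have "3 / 8 < U \<xi>' Firm2"
      using full.full_explanation_payoff[where i = Firm1, OF _ _ nashQ[where \<xi>' = \<xi>', OF \<xi>']] a1
      by (simp add: U_def a_def \<xi>'_def scaled_misfit_def)
    with no_gain[of 1 Firm2] le show False by (simp add: \<xi>'_def)
  next
    assume a2: "1 < a Firm2" and less: "U \<xi> Firm1 < a Firm2 / 2 - 1 / 8"
    define \<xi>' where "\<xi>' = \<xi>(Firm1 := \<xi> Firm2)"
    have \<xi>': "\<xi>' j \<in> {0..1}" for j using \<xi> by (simp add: \<xi>'_def)
    interpret sym: quality_stage "scaled_misfit \<beta> t \<xi>'" "scaled_revenue \<beta> t P \<xi>'"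
      by (rule quality_stage[where \<xi> = \<xi>', OF assms P \<xi>'])
    have v: "scaled_misfit \<beta> t \<xi>' i = a Firm2" for i
      by (cases i) (simp_all add: \<xi>'_def a_def scaled_misfit_def)
    \<comment> \<open>The symmetric quality \<open>3 / 2\<close> in original units; it serves only
      as a witness that triggers the selection.\<close>
    define q where "q = (\<lambda>_ :: firm. 3 / 2 / (18 * \<beta>))"
    have "quality_equilibrium \<beta> t P \<xi>' q"
      using sym.symmetric_equilibrium[OF v a2] assms
      by (simp add: quality_equilibrium_iff[where \<xi> = \<xi>', OF assms P \<xi>'] q_def)
    moreover have "explanation_dominated t \<xi>' q (P \<xi>' q)"
      using explanation_dominated_gap[where \<xi> = \<xi>' and q = q and i = Firm1, OF assms P \<xi>'] a2 assms by (simp add: q_def v)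
    ultimately have "explanation_dominated t \<xi>' (Q \<xi>') (P \<xi>' (Q \<xi>'))"
      using sel \<xi>' unfolding explanation_dominated_selection_def by blast
    \<comment> \<open>The played equilibrium need not be the witness, and either firm may hold the
      higher quality in it; \<open>symmetric_payoff\<close> fixes its payoffs all the same.\<close>
    moreover obtain i where i: "Q \<xi>' (rival i) \<le> Q \<xi>' i"
      by (metis linear rival_rival)
    ultimately have "18 * \<beta> * Q \<xi>' i - 18 * \<beta> * Q \<xi>' (rival i) \<le> 3 / 2 * a Firm2"
      using explanation_dominated_gap[where \<xi> = \<xi>' and q = "Q \<xi>'",
        OF assms P \<xi>' Qnn[where \<xi>' = \<xi>', OF \<xi>'] i] a2 by (simp add: v)
    then have "U \<xi>' Firm1 = a Firm2 / 2 - 1 / 8"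
      unfolding U_def using i assms
      by (intro sym.symmetric_payoff[OF v a2 nashQ[where \<xi>' = \<xi>', OF \<xi>'], of i]) auto
    with no_gain[of "\<xi> Firm2" Firm1] \<xi> less show False by (simp add: \<xi>'_def)
  qed
qed

end
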